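(* (Compatibility.) Let $\Sigma$ be a CoLF signature. If $\cdot;\Theta'\vdash_\Sigma N=N'$ and $\cdot;\Theta\vdash_\Sigma M=M'$, then for every simple type $\tau$, $\cdot;\Theta\cup\Theta'\vdash_\Sigma[N/x]^\tau M=[N'/x]^\tau M'$, provided both hereditary substitutions are defined.
   Context: CoLF terms: $M::=H\cdot S\mid\lambda x.M$, $H::=x\mid c\mid r$ ($r$ recursion constants with definitions $r:A=M\in\Sigma$), spines $S::=()\mid M;S\mid[x];S$. Simple types $\tau::=*\mid\tau_1\to\tau_2$; erasure $(\Pi x{:}A_2.A_1)^o=A_2^o\to A_1^o$, $(\Pi x\,\hat{:}\,A_2.A_1)^o=*\to A_1^o$, atomic types erase to $*$. Hereditary substitution (partial): $[N/x]^\tau(\lambda y.M)=\lambda y.[N/x]^\tau M$; $[N/x]^\tau(x\cdot S)=([N/x]^\tau S)\rhd^\tau N$; $[N/x]^\tau(H\cdot S)=H\cdot[N/x]^\tau S$ ($H\neq x$); componentwise on spines, $[N/x]^\tau([x];S)$ undefined; $()\rhd^*R=R$, $(N;S)\rhd^{\tau_2\to\tau_1}(\lambda x.M)=S\rhd^{\tau_1}([N/x]^{\tau_2}M)$, $([y];S)\rhd^{*\to\tau_1}(\lambda x.M)=S\rhd^{\tau_1}(\{y/x\}M)$. $S\ \mathsf{prepat}$: only prepattern arguments; $M\ \mathsf{contra}$: head not a recursion constant. Equality judgment, $\Delta$ a list of assumptions $\Theta''\vdash H\cdot S_1\doteq H'\cdot S_2$: (1) if such an assumption is in $\Delta$ and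 $\sigma$ is a variable renaming from $\Theta''$ into $\Theta$, conclude $\Delta;\Theta\vdash\sigma(H\cdot S_1)=\sigma(H'\cdot S_2)$; (2) if $r:A=M\in\Sigma$, $S_1\ \mathsf{prepat}$, $M\ \mathsf{contra}$ and $\Delta,(\Theta\vdash r\cdot S_1\doteq H\cdot S_2);\Theta\vdash S_1\rhd^{A^o}M=H\cdot S_2$, conclude $r\cdot S_1=H\cdot S_2$; (3) if $r:A=M\in\Sigma$, $S_2\ \mathsf{prepat}$, $M\ \mathsf{contra}$, $H$ not a recursion constant and $\Delta,(\Theta\vdash H\cdot S_1\doteq r\cdot S_2);\Theta\vdash H\cdot S_1=S_2\rhd^{A^o}M$, conclude $H\cdot S_1=r\cdot S_2$; (4) $c\cdot S=c\cdot S'$ from $S=S'$; (5) $y\cdot S=y\cdot S'$ from $S=S'$; (6) $\lambda x.M=\lambda x.M'$ from $\Delta;\Theta,x\vdash M=M'$; spines: $()=()$, $M;S=M';S'$ from both components, $[x];S=[x];S'$ from $S=S'$. *)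

theory Defs
  imports "HOL-Library.FSet"
begin

text \<open>
  Terms are represented locally nameless: free variables are names, variables bound by a
  \<open>\<lambda>\<close> or \<open>\<Pi>\<close> are de Bruijn indices, so that syntactic identity is identity up to renaming of
  bound variables.  The body of a binder is inspected by replacing its outermost index by a
  fresh name (\<open>open_tm 0 z\<close>).
\<close>

type_synonym name = nat
type_synonym const = string

datatype var = Free name | Bound nat

datatype head = Var var | Const const | Rec const

datatype tm = Root head spine | Lam tm
and spine = SNil | App tm spine | PApp var spine  \<comment> \<open>\<open>()\<close>, \<open>M;S\<close>, \<open>[x];S\<close>\<close>

text \<open>\<open>PPi\<close> and \<open>KPPi\<close> are the products \<open>\<Pi>x :^ A. _\<close> over prepattern variables.\<close>

datatype ty = Atom const spine | Pi ty ty | PPi ty ty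

datatype kind = KType | KCotype | KPi ty kind | KPPi ty kind

datatype decl =
    FamDecl const kind
  | ConDecl const ty
  | RecDef const ty tm

type_synonym sig = "decl list"

datatype sty = Star | Arr sty sty

primrec erase :: "ty \<Rightarrow> sty" where
  "erase (Atom a S) = Star"
| "erase (Pi A B) = Arr (erase A) (erase B)"
| "erase (PPi A B) = Arr Star (erase B)"


subsection \<open>Free variables, local closure, opening, renaming\<close>

primrec fv_var :: "var \<Rightarrow> name set" where
  "fv_var (Free x) = {x}"
| "fv_var (Bound i) = {}"

primrec fv_head :: "head \<Rightarrow> name set" where
  "fv_head (Var v) = fv_var v"
| "fv_head (Const c) = {}"
| "fv_head (Rec r) = {}"

primrec fv_tm :: "tm \<Rightarrow> name set" and fv_spine :: "spine \<Rightarrow> name set" where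
  "fv_tm (Root H S) = fv_head H \<union> fv_spine S"
| "fv_tm (Lam M) = fv_tm M"
| "fv_spine SNil = {}"
| "fv_spine (App M S) = fv_tm M \<union> fv_spine S"
| "fv_spine (PApp v S) = fv_var v \<union> fv_spine S"

primrec fv_ty :: "ty \<Rightarrow> name set" where
  "fv_ty (Atom a S) = fv_spine S"
| "fv_ty (Pi A B) = fv_ty A \<union> fv_ty B"
| "fv_ty (PPi A B) = fv_ty A \<union> fv_ty B"

primrec fv_kind :: "kind \<Rightarrow> name set" where
  "fv_kind KType = {}"
| "fv_kind KCotype = {}"
| "fv_kind (KPi A K) = fv_ty A \<union> fv_kind K"
| "fv_kind (KPPi A K) = fv_ty A \<union> fv_kind K"

text \<open>\<open>lc_* k e\<close>: all indices of \<open>e\<close> are bound in \<open>e\<close> or by one of \<open>k\<close> enclosing binders.\<close>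

primrec lc_var :: "nat \<Rightarrow> var \<Rightarrow> bool" where
  "lc_var k (Free x) = True"
| "lc_var k (Bound i) = (i < k)"

primrec lc_head :: "nat \<Rightarrow> head \<Rightarrow> bool" where
  "lc_head k (Var v) = lc_var k v"
| "lc_head k (Const c) = True"
| "lc_head k (Rec r) = True"

primrec lc_tm :: "nat \<Rightarrow> tm \<Rightarrow> bool" and lc_spine :: "nat \<Rightarrow> spine \<Rightarrow> bool" where
  "lc_tm k (Root H S) = (lc_head k H \<and> lc_spine k S)"
| "lc_tm k (Lam M) = lc_tm (Suc k) M"
| "lc_spine k SNil = True"
| "lc_spine k (App M S) = (lc_tm k M \<and> lc_spine k S)"
| "lc_spine k (PApp v S) = (lc_var k v \<and> lc_spine k S)"

primrec lc_ty :: "nat \<Rightarrow> ty \<Rightarrow> bool" where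
  "lc_ty k (Atom a S) = lc_spine k S"
| "lc_ty k (Pi A B) = (lc_ty k A \<and> lc_ty (Suc k) B)"
| "lc_ty k (PPi A B) = (lc_ty k A \<and> lc_ty (Suc k) B)"

primrec lc_kind :: "nat \<Rightarrow> kind \<Rightarrow> bool" where
  "lc_kind k KType = True"
| "lc_kind k KCotype = True"
| "lc_kind k (KPi A K) = (lc_ty k A \<and> lc_kind (Suc k) K)"
| "lc_kind k (KPPi A K) = (lc_ty k A \<and> lc_kind (Suc k) K)"

text \<open>The proper terms; their free variables are all named.\<close>

abbreviation is_tm :: "tm \<Rightarrow> bool" where
  "is_tm M \<equiv> lc_tm 0 M"

primrec open_var :: "nat \<Rightarrow> name \<Rightarrow> var \<Rightarrow> var" where
  "open_var k z (Free x) = Free x"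
| "open_var k z (Bound i) = (if i = k then Free z else Bound i)"

primrec open_head :: "nat \<Rightarrow> name \<Rightarrow> head \<Rightarrow> head" where
  "open_head k z (Var v) = Var (open_var k z v)"
| "open_head k z (Const c) = Const c"
| "open_head k z (Rec r) = Rec r"

primrec open_tm :: "nat \<Rightarrow> name \<Rightarrow> tm \<Rightarrow> tm"
  and open_spine :: "nat \<Rightarrow> name \<Rightarrow> spine \<Rightarrow> spine" where
  "open_tm k z (Root H S) = Root (open_head k z H) (open_spine k z S)"
| "open_tm k z (Lam M) = Lam (open_tm (Suc k) z M)"
| "open_spine k z SNil = SNil"
| "open_spine k z (App M S) = App (open_tm k z M) (open_spine k z S)"
| "open_spine k z (PApp v S) = PApp (open_var k z v) (open_spine k z S)"

primrec ren_var :: "(name \<Rightarrow> name) \<Rightarrow> var \<Rightarrow> var" where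
  "ren_var \<sigma> (Free x) = Free (\<sigma> x)"
| "ren_var \<sigma> (Bound i) = Bound i"

primrec ren_head :: "(name \<Rightarrow> name) \<Rightarrow> head \<Rightarrow> head" where
  "ren_head \<sigma> (Var v) = Var (ren_var \<sigma> v)"
| "ren_head \<sigma> (Const c) = Const c"
| "ren_head \<sigma> (Rec r) = Rec r"

primrec ren_tm :: "(name \<Rightarrow> name) \<Rightarrow> tm \<Rightarrow> tm"
  and ren_spine :: "(name \<Rightarrow> name) \<Rightarrow> spine \<Rightarrow> spine" where
  "ren_tm \<sigma> (Root H S) = Root (ren_head \<sigma> H) (ren_spine \<sigma> S)"
| "ren_tm \<sigma> (Lam M) = Lam (ren_tm \<sigma> M)"
| "ren_spine \<sigma> SNil = SNil"
| "ren_spine \<sigma> (App M S) = App (ren_tm \<sigma> M) (ren_spine \<sigma> S)"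
| "ren_spine \<sigma> (PApp v S) = PApp (ren_var \<sigma> v) (ren_spine \<sigma> S)"

text \<open>\<sigma> maps \<open>\<Theta>''\<close> into \<open>\<Theta>\<close>, not necessarily injectively, and fixes all other names.\<close>

definition renaming :: "(name \<Rightarrow> name) \<Rightarrow> name fset \<Rightarrow> name fset \<Rightarrow> bool" where
  "renaming \<sigma> \<Theta>'' \<Theta> \<longleftrightarrow> (\<forall>x. x |\<in>| \<Theta>'' \<longrightarrow> \<sigma> x |\<in>| \<Theta>) \<and> (\<forall>x. x |\<notin>| \<Theta>'' \<longrightarrow> \<sigma> x = x)"


subsection \<open>Signatures\<close>

primrec decl_name :: "decl \<Rightarrow> const" where
  "decl_name (FamDecl a K) = a"
| "decl_name (ConDecl c A) = c"
| "decl_name (RecDef r A M) = r"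

primrec closed_decl :: "decl \<Rightarrow> bool" where
  "closed_decl (FamDecl a K) = (lc_kind 0 K \<and> fv_kind K = {})"
| "closed_decl (ConDecl c A) = (lc_ty 0 A \<and> fv_ty A = {})"
| "closed_decl (RecDef r A M) = (lc_ty 0 A \<and> fv_ty A = {} \<and> lc_tm 0 M \<and> fv_tm M = {})"

definition colf_signature :: "sig \<Rightarrow> bool" where
  "colf_signature \<Sigma> \<longleftrightarrow> distinct (map decl_name \<Sigma>) \<and> (\<forall>d \<in> set \<Sigma>. closed_decl d)"


subsection \<open>Hereditary substitution\<close>

text \<open>
  The partial operations are given by their graphs: \<open>hsubst \<tau> N x M P\<close> means that
  \<open>[N/x]\<^sup>\<tau> M\<close> is defined and equal to \<open>P\<close>, likewise \<open>hsubst_spine\<close> on spines, and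
  \<open>hreduce \<tau> S N P\<close> means that \<open>S \<rhd>\<^sup>\<tau> N\<close> is defined and equal to \<open>P\<close>.
  There is no rule for \<open>[N/x]\<^sup>\<tau> ([x];S)\<close>.
\<close>

inductive hsubst :: "sty \<Rightarrow> tm \<Rightarrow> name \<Rightarrow> tm \<Rightarrow> tm \<Rightarrow> bool"
  and hsubst_spine :: "sty \<Rightarrow> tm \<Rightarrow> name \<Rightarrow> spine \<Rightarrow> spine \<Rightarrow> bool"
  and hreduce :: "sty \<Rightarrow> spine \<Rightarrow> tm \<Rightarrow> tm \<Rightarrow> bool"
where
  hsubst_Lam:
    "z \<notin> {x} \<union> fv_tm N \<union> fv_tm M \<union> fv_tm P \<Longrightarrow>
     hsubst \<tau> N x (open_tm 0 z M) (open_tm 0 z P) \<Longrightarrow>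
     hsubst \<tau> N x (Lam M) (Lam P)"
| hsubst_Root_same:
    "hsubst_spine \<tau> N x S S' \<Longrightarrow> hreduce \<tau> S' N P \<Longrightarrow>
     hsubst \<tau> N x (Root (Var (Free x)) S) P"
| hsubst_Root_other:
    "H \<noteq> Var (Free x) \<Longrightarrow> hsubst_spine \<tau> N x S S' \<Longrightarrow>
     hsubst \<tau> N x (Root H S) (Root H S')"
| hsubst_SNil:
    "hsubst_spine \<tau> N x SNil SNil"
| hsubst_App:
    "hsubst \<tau> N x M M' \<Longrightarrow> hsubst_spine \<tau> N x S S' \<Longrightarrow>
     hsubst_spine \<tau> N x (App M S) (App M' S')"
| hsubst_PApp:
    "v \<noteq> Free x \<Longrightarrow> hsubst_spine \<tau> N x S S' \<Longrightarrow>
     hsubst_spine \<tau> N x (PApp v S) (PApp v S')"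
| hreduce_SNil:
    "hreduce Star SNil (Root H S) (Root H S)"
| hreduce_App:
    "z \<notin> fv_tm N \<union> fv_tm M \<Longrightarrow> hsubst \<tau>2 N z (open_tm 0 z M) Q \<Longrightarrow> hreduce \<tau>1 S Q P \<Longrightarrow>
     hreduce (Arr \<tau>2 \<tau>1) (App N S) (Lam M) P"
| hreduce_PApp:
    "hreduce \<tau>1 S (open_tm 0 y M) P \<Longrightarrow>
     hreduce (Arr Star \<tau>1) (PApp (Free y) S) (Lam M) P"


subsection \<open>Equality\<close>

primrec prepat :: "spine \<Rightarrow> bool" where
  "prepat SNil = True"
| "prepat (App M S) = False"
| "prepat (PApp v S) = prepat S"

primrec is_rec :: "head \<Rightarrow> bool" where
  "is_rec (Var v) = False"
| "is_rec (Const c) = False"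
| "is_rec (Rec r) = True"

primrec contra :: "tm \<Rightarrow> bool" where
  "contra (Root H S) = (\<not> is_rec H)"
| "contra (Lam M) = contra M"

text \<open>An assumption \<open>\<Theta> \<turnstile> H\<cdot>S\<^sub>1 \<doteq> H'\<cdot>S\<^sub>2\<close> is stored as \<open>(\<Theta>, Root H S\<^sub>1, Root H' S\<^sub>2)\<close>.\<close>

type_synonym assm = "name fset \<times> tm \<times> tm"

inductive eq_tm :: "sig \<Rightarrow> assm list \<Rightarrow> name fset \<Rightarrow> tm \<Rightarrow> tm \<Rightarrow> bool"
  and eq_spine :: "sig \<Rightarrow> assm list \<Rightarrow> name fset \<Rightarrow> spine \<Rightarrow> spine \<Rightarrow> bool"
  for \<Sigma> :: sig
where
  eq_assm:
    "(\<Theta>'', Root H S1, Root H' S2) \<in> set \<Delta> \<Longrightarrow> renaming \<sigma> \<Theta>'' \<Theta> \<Longrightarrow>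
     eq_tm \<Sigma> \<Delta> \<Theta> (ren_tm \<sigma> (Root H S1)) (ren_tm \<sigma> (Root H' S2))"
| eq_unfold_left:
    "RecDef r A M \<in> set \<Sigma> \<Longrightarrow> prepat S1 \<Longrightarrow> contra M \<Longrightarrow> hreduce (erase A) S1 M P \<Longrightarrow>
     eq_tm \<Sigma> (\<Delta> @ [(\<Theta>, Root (Rec r) S1, Root H S2)]) \<Theta> P (Root H S2) \<Longrightarrow>
     eq_tm \<Sigma> \<Delta> \<Theta> (Root (Rec r) S1) (Root H S2)"
| eq_unfold_right:
    "RecDef r A M \<in> set \<Sigma> \<Longrightarrow> prepat S2 \<Longrightarrow> contra M \<Longrightarrow> \<not> is_rec H \<Longrightarrow>
     hreduce (erase A) S2 M P \<Longrightarrow>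
     eq_tm \<Sigma> (\<Delta> @ [(\<Theta>, Root H S1, Root (Rec r) S2)]) \<Theta> (Root H S1) P \<Longrightarrow>
     eq_tm \<Sigma> \<Delta> \<Theta> (Root H S1) (Root (Rec r) S2)"
| eq_const:
    "eq_spine \<Sigma> \<Delta> \<Theta> S S' \<Longrightarrow> eq_tm \<Sigma> \<Delta> \<Theta> (Root (Const c) S) (Root (Const c) S')"
| eq_var:
    "eq_spine \<Sigma> \<Delta> \<Theta> S S' \<Longrightarrow>
     eq_tm \<Sigma> \<Delta> \<Theta> (Root (Var (Free y)) S) (Root (Var (Free y)) S')"
| eq_Lam:
    "z \<notin> fset \<Theta> \<union> fv_tm M \<union> fv_tm M' \<Longrightarrow>
     eq_tm \<Sigma> \<Delta> (finsert z \<Theta>) (open_tm 0 z M) (open_tm 0 z M') \<Longrightarrow>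
     eq_tm \<Sigma> \<Delta> \<Theta> (Lam M) (Lam M')"
| eq_SNil:
    "eq_spine \<Sigma> \<Delta> \<Theta> SNil SNil"
| eq_App:
    "eq_tm \<Sigma> \<Delta> \<Theta> M M' \<Longrightarrow> eq_spine \<Sigma> \<Delta> \<Theta> S S' \<Longrightarrow>
     eq_spine \<Sigma> \<Delta> \<Theta> (App M S) (App M' S')"
| eq_PApp:
    "eq_spine \<Sigma> \<Delta> \<Theta> S S' \<Longrightarrow>
     eq_spine \<Sigma> \<Delta> \<Theta> (PApp (Free y) S) (PApp (Free y) S')"

end

theory Submission imports Defs begin

text \<open>
  Derivability of \<open>\<cdot>; \<Theta> \<turnstile> M = M'\<close> does not depend on \<open>\<Theta>\<close>: it coincides with bisimilarity of the
  infinite trees obtained by unfolding recursion constants.  A derivation yields a bisimulation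
  up to renaming, since every assumption of \<open>\<Delta>\<close> is discharged by one unfolding.  Conversely, a
  search for a derivation between bisimilar terms terminates: unfolding on prepattern spines
  only renames, so all terms met have bounded size over finitely many constants, and up to
  injective renaming there are finitely many pairs that can enter \<open>\<Delta>\<close>.

  Bisimilarity is stable under all renamings, which is needed for prepattern arguments, where
  the renaming \<open>{y/x}\<close> may identify variables.  It is compatible with hereditary
  substitution, by induction on one of the two substitution derivations.  At a recursion constant
  both substitutions are the identity: its spine is prepattern, hence free of \<open>x\<close> if the
  substitution is defined, hence \<open>x\<close> does not occur in its unfolding; on the other side \<open>x\<close> could
  then only occur in a spine of a recursion constant, where substitution is undefined.
\<close>

subsection \<open>Renaming and opening\<close>

lemma mem_fv_var: "x \<in> fv_var v \<longleftrightarrow> v = Free x"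
  by (cases v) auto

lemma mem_fv_head: "x \<in> fv_head H \<longleftrightarrow> H = Var (Free x)"
  by (cases H) (auto simp: mem_fv_var)

lemma finite_fv_var [simp]: "finite (fv_var v)"
  by (cases v) auto

lemma finite_fv_head [simp]: "finite (fv_head H)"
  by (cases H) auto

lemma finite_fv [simp]: "finite (fv_tm M)" "finite (fv_spine S)"
  by (induct M and S rule: tm.induct spine.induct) auto

lemma ren_var_cong: "(\<And>x. x \<in> fv_var v \<Longrightarrow> \<sigma> x = \<rho> x) \<Longrightarrow> ren_var \<sigma> v = ren_var \<rho> v"
  by (cases v) auto

lemma ren_head_cong: "(\<And>x. x \<in> fv_head H \<Longrightarrow> \<sigma> x = \<rho> x) \<Longrightarrow> ren_head \<sigma> H = ren_head \<rho> H"
  by (cases H) (auto intro: ren_var_cong)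

lemma ren_cong:
  "(\<And>x. x \<in> fv_tm M \<Longrightarrow> \<sigma> x = \<rho> x) \<Longrightarrow> ren_tm \<sigma> M = ren_tm \<rho> M"
  "(\<And>x. x \<in> fv_spine S \<Longrightarrow> \<sigma> x = \<rho> x) \<Longrightarrow> ren_spine \<sigma> S = ren_spine \<rho> S"
  by (induct M and S rule: tm.induct spine.induct) (auto intro: ren_head_cong ren_var_cong)

lemma ren_var_id [simp]: "ren_var (\<lambda>x. x) v = v"
  by (cases v) auto

lemma ren_head_id [simp]: "ren_head (\<lambda>x. x) H = H"
  by (cases H) auto

lemma ren_id [simp]: "ren_tm (\<lambda>x. x) M = M" "ren_spine (\<lambda>x. x) S = S"
  by (induct M and S rule: tm.induct spine.induct) auto

lemma ren_fresh:
  "(\<And>x. x \<in> fv_tm M \<Longrightarrow> \<sigma> x = x) \<Longrightarrow> ren_tm \<sigma> M = M"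
  using ren_cong(1)[of M \<sigma> "\<lambda>x. x"] by simp

lemma ren_var_comp [simp]: "ren_var \<sigma> (ren_var \<rho> v) = ren_var (\<lambda>x. \<sigma> (\<rho> x)) v"
  by (cases v) auto

lemma ren_head_comp [simp]: "ren_head \<sigma> (ren_head \<rho> H) = ren_head (\<lambda>x. \<sigma> (\<rho> x)) H"
  by (cases H) auto

lemma ren_comp [simp]:
  "ren_tm \<sigma> (ren_tm \<rho> M) = ren_tm (\<lambda>x. \<sigma> (\<rho> x)) M"
  "ren_spine \<sigma> (ren_spine \<rho> S) = ren_spine (\<lambda>x. \<sigma> (\<rho> x)) S"
  by (induct M and S rule: tm.induct spine.induct) auto

lemma fv_ren_var [simp]: "fv_var (ren_var \<sigma> v) = \<sigma> ` fv_var v"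
  by (cases v) auto

lemma fv_ren_head [simp]: "fv_head (ren_head \<sigma> H) = \<sigma> ` fv_head H"
  by (cases H) auto

lemma fv_ren [simp]:
  "fv_tm (ren_tm \<sigma> M) = \<sigma> ` fv_tm M"
  "fv_spine (ren_spine \<sigma> S) = \<sigma> ` fv_spine S"
  by (induct M and S rule: tm.induct spine.induct) auto

lemma ren_open_var: "ren_var \<sigma> (open_var k z v) = open_var k (\<sigma> z) (ren_var \<sigma> v)"
  by (cases v) auto

lemma ren_open_head: "ren_head \<sigma> (open_head k z H) = open_head k (\<sigma> z) (ren_head \<sigma> H)"
  by (cases H) (auto simp: ren_open_var)

lemma ren_open:
  "ren_tm \<sigma> (open_tm k z M) = open_tm k (\<sigma> z) (ren_tm \<sigma> M)"
  "ren_spine \<sigma> (open_spine k z S) = open_spine k (\<sigma> z) (ren_spine \<sigma> S)"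
  by (induct M and S arbitrary: k and k rule: tm.induct spine.induct) (auto simp: ren_open_head ren_open_var)

lemma fv_open_var: "fv_var (open_var k z v) \<subseteq> insert z (fv_var v)" "fv_var v \<subseteq> fv_var (open_var k z v)"
  by (cases v; auto)+

lemma fv_open_head: "fv_head (open_head k z H) \<subseteq> insert z (fv_head H)" "fv_head H \<subseteq> fv_head (open_head k z H)"
  using fv_open_var by (cases H; auto)+

lemma fv_open_upper:
  "fv_tm (open_tm k z M) \<subseteq> insert z (fv_tm M)"
  "fv_spine (open_spine k z S) \<subseteq> insert z (fv_spine S)"
  using fv_open_var(1) fv_open_head(1)
  by (induct M and S arbitrary: k and k rule: tm.induct spine.induct) (auto, blast+)

lemma fv_open_lower:
  "fv_tm M \<subseteq> fv_tm (open_tm k z M)"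
  "fv_spine S \<subseteq> fv_spine (open_spine k z S)"
  using fv_open_var(2) fv_open_head(2)
  by (induct M and S arbitrary: k and k rule: tm.induct spine.induct) (auto, blast+)

lemma ren_upd_fresh:
  "z \<notin> fv_tm M \<Longrightarrow> ren_tm (\<sigma>(z := w)) M = ren_tm \<sigma> M"
  by (rule ren_cong) auto

text \<open>Redirecting the opening name \<open>z\<close> to \<open>w\<close> while applying
  \<open>\<sigma>\<close>: the binder cases below use this equation to replace a given fresh name by
  one that suits several terms at once.\<close>

lemma ren_upd_open:
  "z \<notin> fv_tm M \<Longrightarrow> ren_tm (\<sigma>(z := w)) (open_tm k z M) = open_tm k w (ren_tm \<sigma> M)"
  by (simp add: ren_open ren_upd_fresh)

lemma rename_open:
  "z \<notin> fv_tm M \<Longrightarrow> ren_tm ((\<lambda>x. x)(z := w)) (open_tm k z M) = open_tm k w M"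
  by (simp add: ren_upd_open)

section \<open>Injectivity of opening and renaming\<close>

lemma open_var_inj:
  "z \<notin> fv_var v \<Longrightarrow> z \<notin> fv_var v' \<Longrightarrow> open_var k z v = open_var k z v' \<Longrightarrow> v = v'"
  by (cases v; cases v') (auto split: if_splits)

lemma open_head_inj:
  "z \<notin> fv_head H \<Longrightarrow> z \<notin> fv_head H' \<Longrightarrow> open_head k z H = open_head k z H' \<Longrightarrow> H = H'"
  by (cases H; cases H') (auto dest: open_var_inj)

lemma open_inj:
  "z \<notin> fv_tm M \<Longrightarrow> z \<notin> fv_tm M' \<Longrightarrow> open_tm k z M = open_tm k z M' \<Longrightarrow> M = M'"
  "z \<notin> fv_spine S \<Longrightarrow> z \<notin> fv_spine S' \<Longrightarrow> open_spine k z S = open_spine k z S' \<Longrightarrow> S = S'"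
proof (induct M and S arbitrary: k M' and k S' rule: tm.induct spine.induct)
  case (Root H S) then show ?case by (cases M') (auto dest: open_head_inj)
next
  case (Lam M) then show ?case by (cases M') auto
next
  case SNil then show ?case by (cases S') auto
next
  case (App M S) then show ?case by (cases S') auto
next
  case (PApp v S) then show ?case by (cases S') (auto dest: open_var_inj)
qed

lemma ren_var_inj:
  "inj_on \<kappa> V \<Longrightarrow> fv_var v \<subseteq> V \<Longrightarrow> fv_var v' \<subseteq> V \<Longrightarrow> ren_var \<kappa> v = ren_var \<kappa> v' \<Longrightarrow> v = v'"
  by (cases v; cases v') (auto dest: inj_onD)

lemma ren_head_inj:
  "inj_on \<kappa> V \<Longrightarrow> fv_head H \<subseteq> V \<Longrightarrow> fv_head H' \<subseteq> V \<Longrightarrow> ren_head \<kappa> H = ren_head \<kappa> H' \<Longrightarrow> H = H'"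
  by (cases H; cases H') (auto dest: ren_var_inj)

text \<open>Injectivity is asked only on a set \<open>V\<close> that contains the free variables of
  both terms, because the canonical namings of the proof search are injective only on such a
  set.\<close>

lemma ren_inj:
  "inj_on \<kappa> V \<Longrightarrow> fv_tm M \<subseteq> V \<Longrightarrow> fv_tm M' \<subseteq> V \<Longrightarrow> ren_tm \<kappa> M = ren_tm \<kappa> M' \<Longrightarrow> M = M'"
  "inj_on \<kappa> V \<Longrightarrow> fv_spine S \<subseteq> V \<Longrightarrow> fv_spine S' \<subseteq> V \<Longrightarrow> ren_spine \<kappa> S = ren_spine \<kappa> S' \<Longrightarrow> S = S'"
proof (induct M and S arbitrary: M' and S' rule: tm.induct spine.induct)
  case (Root H S) then show ?case by (cases M') (auto dest: ren_head_inj)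
next
  case (Lam M) then show ?case by (cases M') auto
next
  case SNil then show ?case by (cases S') auto
next
  case (App M S) then show ?case by (cases S') auto
next
  case (PApp v S) then show ?case by (cases S') (auto dest: ren_var_inj)
qed

lemma fresh_name:
  assumes "finite (X :: name set)"
  obtains z where "z \<notin> X"
  using ex_new_if_finite[OF infinite_UNIV_nat assms] by blast

lemma is_rec_ren [simp]: "is_rec (ren_head \<sigma> H) = is_rec H"
  by (cases H) auto

lemma is_rec_open [simp]: "is_rec (open_head k z H) = is_rec H"
  by (cases H) auto

lemma contra_open [simp]: "contra (open_tm k z M) = contra M"
proof -
  \<comment> \<open>The mutual induction rule wants a claim about spines as well;
    \<open>contra\<close> never looks into them, so \<open>True\<close> fills the place.\<close>
  have "contra (open_tm k z M) = contra M" "True" for S :: spine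
    by (induct M and S arbitrary: k and k rule: tm.induct spine.induct) auto
  then show ?thesis by simp
qed

subsection \<open>Hereditary substitution\<close>

text \<open>Each inner substitution eliminates the fresh name that opened its binder, so no variable
  is left over. For closed definition bodies this shows that unfolding adds no free
  variables.\<close>

lemma fv_hsubst:
  "hsubst \<tau> N x M P \<Longrightarrow> fv_tm P \<subseteq> (fv_tm M - {x}) \<union> fv_tm N"
  "hsubst_spine \<tau> N x S S' \<Longrightarrow> fv_spine S' \<subseteq> (fv_spine S - {x}) \<union> fv_tm N"
  "hreduce \<tau> S N P \<Longrightarrow> fv_tm P \<subseteq> fv_spine S \<union> fv_tm N"
proof (induct rule: hsubst_hsubst_spine_hreduce.inducts)
  case (hsubst_Lam z x N M P \<tau>)
  then show ?case using fv_open_upper(1)[of 0 z M] fv_open_lower(1)[of P 0 z] by auto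
next
  case (hsubst_Root_other H x \<tau> N S S')
  have "x \<notin> fv_head H"
    using hsubst_Root_other(1) by (simp add: mem_fv_head)
  then show ?case using hsubst_Root_other by auto
next
  case (hsubst_PApp v x \<tau> N S S')
  have "x \<notin> fv_var v"
    using hsubst_PApp(1) by (simp add: mem_fv_var)
  then show ?case using hsubst_PApp by auto
next
  case (hreduce_App z N M \<tau>2 Q \<tau>1 S P)
  then show ?case using fv_open_upper(1)[of 0 z M] by auto
next
  case (hreduce_PApp \<tau>1 S y M P)
  then show ?case using fv_open_upper(1)[of 0 y M] by auto
qed auto

text \<open>The side condition keeps \<open>\<sigma>\<close> from sending another free variable onto
  \<open>\<sigma> x\<close>, which would create new occurrences to substitute for. In
  \<open>hreduce\<close> the substituted variable is bound, so its name can always be chosen to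
  avoid such a clash.\<close>

lemma ren_hsubst:
  "hsubst \<tau> N x M P \<Longrightarrow> (\<And>y. y \<in> fv_tm M \<Longrightarrow> \<sigma> y = \<sigma> x \<Longrightarrow> y = x) \<Longrightarrow>
     hsubst \<tau> (ren_tm \<sigma> N) (\<sigma> x) (ren_tm \<sigma> M) (ren_tm \<sigma> P)"
  "hsubst_spine \<tau> N x S S' \<Longrightarrow> (\<And>y. y \<in> fv_spine S \<Longrightarrow> \<sigma> y = \<sigma> x \<Longrightarrow> y = x) \<Longrightarrow>
     hsubst_spine \<tau> (ren_tm \<sigma> N) (\<sigma> x) (ren_spine \<sigma> S) (ren_spine \<sigma> S')"
  "hreduce \<tau> S N P \<Longrightarrow> hreduce \<tau> (ren_spine \<sigma> S) (ren_tm \<sigma> N) (ren_tm \<sigma> P)"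
proof (induct arbitrary: \<sigma> and \<sigma> and \<sigma> rule: hsubst_hsubst_spine_hreduce.inducts)
  case (hsubst_Lam z x N M P \<tau>)
  obtain w where w: "w \<notin> {\<sigma> x} \<union> fv_tm (ren_tm \<sigma> N) \<union> fv_tm (ren_tm \<sigma> M) \<union> fv_tm (ren_tm \<sigma> P)"
    by (rule fresh_name[of "{\<sigma> x} \<union> fv_tm (ren_tm \<sigma> N) \<union> fv_tm (ren_tm \<sigma> M) \<union> fv_tm (ren_tm \<sigma> P)"]) auto
  have z: "z \<noteq> x" "z \<notin> fv_tm N" "z \<notin> fv_tm M" "z \<notin> fv_tm P" using hsubst_Lam(1) by auto
  have "hsubst \<tau> (ren_tm (\<sigma>(z := w)) N) ((\<sigma>(z := w)) x)
      (ren_tm (\<sigma>(z := w)) (open_tm 0 z M)) (ren_tm (\<sigma>(z := w)) (open_tm 0 z P))"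
  proof (rule hsubst_Lam(3))
    fix y assume "y \<in> fv_tm (open_tm 0 z M)" "(\<sigma>(z := w)) y = (\<sigma>(z := w)) x"
    then show "y = x" using fv_open_upper(1)[of 0 z M] hsubst_Lam(4)[of y] w z
      by (auto split: if_splits)
  qed
  then have "hsubst \<tau> (ren_tm \<sigma> N) (\<sigma> x) (open_tm 0 w (ren_tm \<sigma> M)) (open_tm 0 w (ren_tm \<sigma> P))"
    using z by (simp add: ren_upd_open ren_upd_fresh)
  then show ?case using w by (simp add: hsubst_hsubst_spine_hreduce.hsubst_Lam)
next
  case (hsubst_Root_same \<tau> N x S S' P)
  then show ?case by (auto intro: hsubst_hsubst_spine_hreduce.hsubst_Root_same)
next
  case (hsubst_Root_other H x \<tau> N S S')
  have "ren_head \<sigma> H \<noteq> Var (Free (\<sigma> x))"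
  proof
    assume "ren_head \<sigma> H = Var (Free (\<sigma> x))"
    then obtain y where "H = Var (Free y)" "\<sigma> y = \<sigma> x"
      by (cases H; simp; metis ren_var.simps var.exhaust var.inject(1) var.distinct(1))
    then show False using hsubst_Root_other(1) hsubst_Root_other(4)[of y] by auto
  qed
  then show ?case using hsubst_Root_other
    by (auto intro: hsubst_hsubst_spine_hreduce.hsubst_Root_other)
next
  case (hsubst_PApp v x \<tau> N S S')
  have "ren_var \<sigma> v \<noteq> Free (\<sigma> x)"
    using hsubst_PApp(1) hsubst_PApp(4) by (cases v) auto
  then show ?case using hsubst_PApp
    by (auto intro: hsubst_hsubst_spine_hreduce.hsubst_PApp)
next
  case (hreduce_App z N M \<tau>2 Q \<tau>1 S P)
  obtain w where w: "w \<notin> fv_tm (ren_tm \<sigma> N) \<union> fv_tm (ren_tm \<sigma> M)"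
    by (rule fresh_name[of "fv_tm (ren_tm \<sigma> N) \<union> fv_tm (ren_tm \<sigma> M)"]) auto
  have z: "z \<notin> fv_tm N" "z \<notin> fv_tm M" using hreduce_App(1) by auto
  have zQ: "z \<notin> fv_tm Q" using fv_hsubst(1)[OF hreduce_App(2)] z by auto
  have "hsubst \<tau>2 (ren_tm (\<sigma>(z := w)) N) ((\<sigma>(z := w)) z)
      (ren_tm (\<sigma>(z := w)) (open_tm 0 z M)) (ren_tm (\<sigma>(z := w)) Q)"
  proof (rule hreduce_App(3))
    fix y assume "y \<in> fv_tm (open_tm 0 z M)" "(\<sigma>(z := w)) y = (\<sigma>(z := w)) z"
    then show "y = z" using fv_open_upper(1)[of 0 z M] w by (auto split: if_splits)
  qed
  then have "hsubst \<tau>2 (ren_tm \<sigma> N) w (open_tm 0 w (ren_tm \<sigma> M)) (ren_tm \<sigma> Q)"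
    using z zQ by (simp add: ren_upd_open ren_upd_fresh)
  then show ?case using w hreduce_App(5)[of \<sigma>]
    by (simp add: hsubst_hsubst_spine_hreduce.hreduce_App[where z = w])
next
  case (hreduce_PApp \<tau>1 S y M P)
  from hreduce_PApp(2)[of \<sigma>] show ?case
    by (simp add: ren_open hsubst_hsubst_spine_hreduce.hreduce_PApp)
qed (auto intro: hsubst_hsubst_spine_hreduce.intros)

section \<open>Inversion rules and prepattern spines\<close>

inductive_cases hsubst_LamE: "hsubst \<tau> N x (Lam M) P"
inductive_cases hsubst_RootE: "hsubst \<tau> N x (Root H S) P"
inductive_cases hsubst_SNilE: "hsubst_spine \<tau> N x SNil S'"
inductive_cases hsubst_AppE: "hsubst_spine \<tau> N x (App M S) S'"
inductive_cases hsubst_PAppE: "hsubst_spine \<tau> N x (PApp v S) S'"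
inductive_cases hreduce_SNilE: "hreduce \<tau> SNil N P"
inductive_cases hreduce_AppE: "hreduce \<tau> (App M S) N P"
inductive_cases hreduce_PAppE: "hreduce \<tau> (PApp v S) N P"

text \<open>Induction on spines alone: the predicate on terms is trivially true, which leaves the
  numbered cases \<open>SNil\<close>, \<open>App\<close>, \<open>PApp\<close>.\<close>

lemmas spine_induct = spine.induct[where ?P1.0 = "\<lambda>_. True", OF TrueI TrueI]

lemma prepat_ren [simp]: "prepat (ren_spine \<sigma> S) = prepat S"
  by (induct S rule: spine_induct) auto

text \<open>Substitution for \<open>x\<close> is undefined on an argument \<open>[x]\<close>. On a
  prepattern spine, being defined thus already forces \<open>x\<close> to be absent, and nothing is
  left to change.\<close>

lemma hsubst_prepat_id:
  "prepat S \<Longrightarrow> hsubst_spine \<tau> N x S S' \<Longrightarrow> S' = S \<and> x \<notin> fv_spine S"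
  by (induct S arbitrary: S' rule: spine_induct)
    (auto elim!: hsubst_SNilE hsubst_PAppE simp: mem_fv_var)

text \<open>Prepattern arguments only strip leading abstractions and put names for their variables,
  so the head reached is the head of \<open>M\<close> up to opening.\<close>

lemma hreduce_prepat_contra:
  "prepat S \<Longrightarrow> contra M \<Longrightarrow> hreduce \<tau> S M P \<Longrightarrow> \<exists>H S'. P = Root H S' \<and> \<not> is_rec H"
proof (induct S arbitrary: \<tau> M rule: spine_induct)
  case (3 v S)
  then obtain \<tau>' y K where "M = Lam K" "hreduce \<tau>' S (open_tm 0 y K) P"
    by (auto elim!: hreduce_PAppE)
  then show ?case using 3(1)[of "open_tm 0 y K" \<tau>'] 3(2,3) by simp
qed (auto elim!: hreduce_SNilE)

subsection \<open>Bisimilarity\<close>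

text \<open>At most one unfolding is performed, since a contractive body applied to a prepattern
  spine already shows a nonrecursive head. A recursion constant with any other spine is
  stuck.\<close>

inductive whn :: "sig \<Rightarrow> tm \<Rightarrow> tm \<Rightarrow> bool" for \<Sigma> where
  whn_nonrec: "\<not> is_rec H \<Longrightarrow> whn \<Sigma> (Root H S) (Root H S)"
| whn_unfold: "RecDef r A M \<in> set \<Sigma> \<Longrightarrow> prepat S \<Longrightarrow> contra M \<Longrightarrow> hreduce (erase A) S M P \<Longrightarrow>
    whn \<Sigma> (Root (Rec r) S) P"

inductive_cases whn_RootE: "whn \<Sigma> (Root H S) P"
inductive_cases whn_LamE [elim!]: "whn \<Sigma> (Lam M) P"

inductive rel_spine :: "(tm \<Rightarrow> tm \<Rightarrow> bool) \<Rightarrow> spine \<Rightarrow> spine \<Rightarrow> bool" for R where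
  rel_spine_SNil: "rel_spine R SNil SNil"
| rel_spine_App: "R M M' \<Longrightarrow> rel_spine R S S' \<Longrightarrow> rel_spine R (App M S) (App M' S')"
| rel_spine_PApp: "rel_spine R S S' \<Longrightarrow> rel_spine R (PApp (Free y) S) (PApp (Free y) S')"

inductive_cases rel_spine_SNilE: "rel_spine R SNil S'"
inductive_cases rel_spine_AppE: "rel_spine R (App M S) S'"
inductive_cases rel_spine_PAppE: "rel_spine R (PApp v S) S'"

lemma rel_spine_mono [mono]: "(\<And>M M'. R M M' \<longrightarrow> R' M M') \<Longrightarrow> rel_spine R S S' \<longrightarrow> rel_spine R' S S'"
proof
  assume "rel_spine R S S'" "\<And>M M'. R M M' \<longrightarrow> R' M M'"
  then show "rel_spine R' S S'" by (induct rule: rel_spine.induct) (auto intro: rel_spine.intros)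
qed

lemma rel_spine_converse: "rel_spine R S S' \<Longrightarrow> rel_spine (\<lambda>M M'. R M' M) S' S"
  by (induct rule: rel_spine.induct) (auto intro: rel_spine.intros)

lemma rel_spine_ren:
  "rel_spine R S S' \<Longrightarrow> (\<And>M M'. R M M' \<Longrightarrow> R' (ren_tm \<sigma> M) (ren_tm \<sigma> M')) \<Longrightarrow>
    rel_spine R' (ren_spine \<sigma> S) (ren_spine \<sigma> S')"
  by (induct rule: rel_spine.induct) (auto intro: rel_spine.intros)

text \<open>The premise \<open>lc_head 0 H\<close> excludes heads that are dangling indices.\<close>

coinductive bisim :: "sig \<Rightarrow> tm \<Rightarrow> tm \<Rightarrow> bool" for \<Sigma> where
  bisim_Root: "whn \<Sigma> M (Root H S) \<Longrightarrow> whn \<Sigma> M' (Root H S') \<Longrightarrow> lc_head 0 H \<Longrightarrow>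
    rel_spine (bisim \<Sigma>) S S' \<Longrightarrow> bisim \<Sigma> M M'"
| bisim_Lam: "z \<notin> fv_tm M \<union> fv_tm M' \<Longrightarrow> bisim \<Sigma> (open_tm 0 z M) (open_tm 0 z M') \<Longrightarrow>
    bisim \<Sigma> (Lam M) (Lam M')"

inductive_cases bisim_Lam_leftE: "bisim \<Sigma> (Lam M) M'"
inductive_cases bisim_RootE: "bisim \<Sigma> (Root H S) M'"
inductive_cases bisim_Root_rightE: "bisim \<Sigma> M (Root H S)"

lemma whn_result: "whn \<Sigma> M P \<Longrightarrow> \<exists>H S. P = Root H S \<and> \<not> is_rec H"
  by (induct rule: whn.induct) (auto dest: hreduce_prepat_contra)

lemma bisim_sym: "bisim \<Sigma> M M' \<Longrightarrow> bisim \<Sigma> M' M"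
proof (erule bisim.coinduct[of "\<lambda>M M'. bisim \<Sigma> M' M"])
  fix M' M assume "bisim \<Sigma> M M'"
  then show "(\<exists>L H S L' S'. M' = L \<and> M = L' \<and> whn \<Sigma> L (Root H S) \<and> whn \<Sigma> L' (Root H S') \<and>
      lc_head 0 H \<and> rel_spine (\<lambda>x y. bisim \<Sigma> y x \<or> bisim \<Sigma> x y) S S') \<or>
    (\<exists>z L L'. M' = Lam L \<and> M = Lam L' \<and> z \<notin> fv_tm L \<union> fv_tm L' \<and>
      (bisim \<Sigma> (open_tm 0 z L') (open_tm 0 z L) \<or> bisim \<Sigma> (open_tm 0 z L) (open_tm 0 z L')))"
  proof (cases rule: bisim.cases)
    case (bisim_Root H S S')
    have "rel_spine (\<lambda>x y. bisim \<Sigma> y x \<or> bisim \<Sigma> x y) S' S"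
      by (rule rel_spine_mono[rule_format, OF _ rel_spine_converse[OF bisim_Root(4)]]) simp
    then show ?thesis using bisim_Root(1-3) by blast
  next
    case (bisim_Lam z N N')
    then show ?thesis by auto
  qed
qed

section \<open>Closure of bisimilarity under renaming\<close>

locale colf =
  fixes \<Sigma> :: sig
  assumes sig: "colf_signature \<Sigma>"
begin

lemma fv_def: "RecDef r A M \<in> set \<Sigma> \<Longrightarrow> fv_tm M = {}"
  using sig unfolding colf_signature_def by fastforce

text \<open>Definition bodies are closed, so a renaming passes through an unfolding and acts on the
  spine only.\<close>

lemma whn_ren: "whn \<Sigma> M P \<Longrightarrow> whn \<Sigma> (ren_tm \<sigma> M) (ren_tm \<sigma> P)"
proof (induct rule: whn.induct)
  case (whn_nonrec H S)
  then show ?case by (simp add: whn.whn_nonrec)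
next
  case (whn_unfold r A M S P)
  have "ren_tm \<sigma> M = M" using fv_def[OF whn_unfold(1)] by (intro ren_fresh) simp
  then have "hreduce (erase A) (ren_spine \<sigma> S) M (ren_tm \<sigma> P)"
    using ren_hsubst(3)[OF whn_unfold(4), of \<sigma>] by simp
  then show ?case using whn_unfold by (simp add: whn.whn_unfold)
qed

lemma fv_whn: "whn \<Sigma> M P \<Longrightarrow> fv_tm P \<subseteq> fv_tm M"
proof (induct rule: whn.induct)
  case (whn_unfold r A M S P)
  then show ?case using fv_hsubst(3)[OF whn_unfold(4)] fv_def[OF whn_unfold(1)] by simp
qed simp

lemma lc_head_ren [simp]: "lc_head k (ren_head \<sigma> H) = lc_head k H"
proof (cases H)
  case (Var v) then show ?thesis by (cases v) auto
qed auto

text \<open>The closure of \<open>R\<close> under all renamings is a bisimulation: weak heads and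
  spines commute with renaming, and under a binder \<open>\<sigma>\<close> is updated to send the
  old fresh name to a new one. This absorbs the renaming that \<open>eq_assm\<close> applies to a
  stored pair.\<close>

lemma bisim_coinduct_up_to_ren:
  assumes "R M M'"
    and step: "\<And>M M'. R M M' \<Longrightarrow>
      (\<exists>H S S'. whn \<Sigma> M (Root H S) \<and> whn \<Sigma> M' (Root H S') \<and> lc_head 0 H \<and> rel_spine R S S') \<or>
      (\<exists>z N N'. M = Lam N \<and> M' = Lam N' \<and> z \<notin> fv_tm N \<union> fv_tm N' \<and>
         R (open_tm 0 z N) (open_tm 0 z N'))"
  shows "bisim \<Sigma> (ren_tm \<sigma> M) (ren_tm \<sigma> M')"
proof -
  define X where "X = (\<lambda>M M'. \<exists>\<sigma> N N'. M = ren_tm \<sigma> N \<and> M' = ren_tm \<sigma> N' \<and> R N N')"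
  have "X (ren_tm \<sigma> M) (ren_tm \<sigma> M')" unfolding X_def using assms(1) by blast
  then show ?thesis
  proof (rule bisim.coinduct)
    fix M M' assume "X M M'"
    then obtain \<sigma> N N' where M: "M = ren_tm \<sigma> N" "M' = ren_tm \<sigma> N'" "R N N'"
      unfolding X_def by blast
    from step[OF M(3)] show "(\<exists>L H S L' S'. M = L \<and> M' = L' \<and> whn \<Sigma> L (Root H S) \<and>
        whn \<Sigma> L' (Root H S') \<and> lc_head 0 H \<and> rel_spine (\<lambda>x y. X x y \<or> bisim \<Sigma> x y) S S') \<or>
      (\<exists>z L L'. M = Lam L \<and> M' = Lam L' \<and> z \<notin> fv_tm L \<union> fv_tm L' \<and>
        (X (open_tm 0 z L) (open_tm 0 z L') \<or> bisim \<Sigma> (open_tm 0 z L) (open_tm 0 z L')))"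
    proof (elim disjE exE conjE)
      fix H S S' assume a: "whn \<Sigma> N (Root H S)" "whn \<Sigma> N' (Root H S')" "lc_head 0 H" "rel_spine R S S'"
      have "rel_spine (\<lambda>x y. X x y \<or> bisim \<Sigma> x y) (ren_spine \<sigma> S) (ren_spine \<sigma> S')"
        by (rule rel_spine_ren[OF a(4)]) (auto simp: X_def)
      moreover have "whn \<Sigma> M (Root (ren_head \<sigma> H) (ren_spine \<sigma> S))"
        "whn \<Sigma> M' (Root (ren_head \<sigma> H) (ren_spine \<sigma> S'))" "lc_head 0 (ren_head \<sigma> H)"
        using a whn_ren[OF a(1), of \<sigma>] whn_ren[OF a(2), of \<sigma>] M by simp_all
      ultimately show ?thesis by blast
    next
      fix z K K' assume a: "N = Lam K" "N' = Lam K'" "z \<notin> fv_tm K \<union> fv_tm K'"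
        "R (open_tm 0 z K) (open_tm 0 z K')"
      obtain w where w: "w \<notin> fv_tm (ren_tm \<sigma> K) \<union> fv_tm (ren_tm \<sigma> K')"
        by (rule fresh_name[of "fv_tm (ren_tm \<sigma> K) \<union> fv_tm (ren_tm \<sigma> K')"]) auto
      have "X (ren_tm (\<sigma>(z := w)) (open_tm 0 z K)) (ren_tm (\<sigma>(z := w)) (open_tm 0 z K'))"
        unfolding X_def using a(4) by blast
      then have "X (open_tm 0 w (ren_tm \<sigma> K)) (open_tm 0 w (ren_tm \<sigma> K'))"
        using a(3) by (simp add: ren_upd_open)
      then show ?thesis using w M a(1,2) by auto
    qed
  qed
qed

lemma bisim_ren: "bisim \<Sigma> M M' \<Longrightarrow> bisim \<Sigma> (ren_tm \<sigma> M) (ren_tm \<sigma> M')"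
proof (erule bisim_coinduct_up_to_ren)
  fix M M' assume "bisim \<Sigma> M M'"
  then show "(\<exists>H S S'. whn \<Sigma> M (Root H S) \<and> whn \<Sigma> M' (Root H S') \<and> lc_head 0 H \<and>
      rel_spine (bisim \<Sigma>) S S') \<or>
    (\<exists>z N N'. M = Lam N \<and> M' = Lam N' \<and> z \<notin> fv_tm N \<union> fv_tm N' \<and>
      bisim \<Sigma> (open_tm 0 z N) (open_tm 0 z N'))"
    by (simp only: bisim.simps[of \<Sigma> M M']) blast
qed

text \<open>A single fresh opening name is enough to establish bisimilarity of abstractions; closure
  under renaming turns it into every name, including those that occur in the bodies.\<close>

lemma bisim_LamD:
  assumes "bisim \<Sigma> (Lam M) X"
  obtains M' where "X = Lam M'" "\<And>z. bisim \<Sigma> (open_tm 0 z M) (open_tm 0 z M')"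
proof -
  obtain z M' where M': "X = Lam M'" "z \<notin> fv_tm M \<union> fv_tm M'"
    "bisim \<Sigma> (open_tm 0 z M) (open_tm 0 z M')"
    using assms by (auto elim: bisim_Lam_leftE)
  have "bisim \<Sigma> (open_tm 0 w M) (open_tm 0 w M')" for w
    using bisim_ren[OF M'(3), of "(\<lambda>x. x)(z := w)"] M'(2) by (simp add: rename_open)
  then show ?thesis using that M'(1) by blast
qed

subsection \<open>Soundness\<close>

lemma eq_mono:
  "eq_tm \<Sigma> \<Delta> \<Theta> M M' \<Longrightarrow> set \<Delta> \<subseteq> set \<Delta>' \<Longrightarrow> eq_tm \<Sigma> \<Delta>' \<Theta> M M'"
  "eq_spine \<Sigma> \<Delta> \<Theta> S S' \<Longrightarrow> set \<Delta> \<subseteq> set \<Delta>' \<Longrightarrow> eq_spine \<Sigma> \<Delta>' \<Theta> S S'"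
proof (induct arbitrary: \<Delta>' and \<Delta>' rule: eq_tm_eq_spine.inducts)
  case (eq_assm \<Theta>'' H S1 H' S2 \<Delta> \<sigma> \<Theta>)
  then show ?case using eq_tm_eq_spine.eq_assm by blast
next
  case (eq_unfold_left r A M S1 P \<Delta> \<Theta> H S2)
  then have "eq_tm \<Sigma> (\<Delta>' @ [(\<Theta>, Root (Rec r) S1, Root H S2)]) \<Theta> P (Root H S2)"
    by (intro eq_unfold_left(6)) auto
  then show ?case using eq_unfold_left eq_tm_eq_spine.eq_unfold_left by blast
next
  case (eq_unfold_right r A M S2 H P \<Delta> \<Theta> S1)
  then have "eq_tm \<Sigma> (\<Delta>' @ [(\<Theta>, Root H S1, Root (Rec r) S2)]) \<Theta> (Root H S1) P"
    by (intro eq_unfold_right(7)) auto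
  then show ?case using eq_unfold_right eq_tm_eq_spine.eq_unfold_right by blast
qed (auto intro: eq_tm_eq_spine.intros)

text \<open>The pair relates the conclusion of an unfolding rule to its equality premise.\<close>

definition unfold_one :: "tm \<times> tm \<Rightarrow> tm \<times> tm \<Rightarrow> bool" where
  "unfold_one p q \<longleftrightarrow>
    (\<exists>r S1 H S2. p = (Root (Rec r) S1, Root H S2) \<and> whn \<Sigma> (fst p) (fst q) \<and> snd q = snd p) \<or>
    (\<exists>r S1 H S2. p = (Root H S1, Root (Rec r) S2) \<and> \<not> is_rec H \<and> whn \<Sigma> (snd p) (snd q) \<and> fst q = fst p)"

text \<open>Each stored pair is backed by an unfolding whose premise is derivable from the same
  \<open>\<Delta>\<close>, the pair itself included. Coinduction resolves this circularity.\<close>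

definition valid :: "assm list \<Rightarrow> bool" where
  "valid \<Delta> \<longleftrightarrow> (\<forall>(\<Theta>, p) \<in> set \<Delta>. \<exists>q. unfold_one p q \<and> eq_tm \<Sigma> \<Delta> \<Theta> (fst q) (snd q))"

text \<open>The new pair is backed by the premise of the unfolding rule that stored it; the old ones
  keep their backing by weakening.\<close>

lemma valid_snoc:
  assumes "valid \<Delta>" "unfold_one p q" "eq_tm \<Sigma> (\<Delta> @ [(\<Theta>, p)]) \<Theta> (fst q) (snd q)"
  shows "valid (\<Delta> @ [(\<Theta>, p)])"
  unfolding valid_def
proof safe
  fix \<Theta>' t t' assume "(\<Theta>', t, t') \<in> set (\<Delta> @ [(\<Theta>, p)])"
  then consider "(\<Theta>', t, t') \<in> set \<Delta>" | "\<Theta>' = \<Theta>" "(t, t') = p" by auto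
  then show "\<exists>q. unfold_one (t, t') q \<and> eq_tm \<Sigma> (\<Delta> @ [(\<Theta>, p)]) \<Theta>' (fst q) (snd q)"
  proof cases
    case 1
    then obtain q' where "unfold_one (t, t') q'" "eq_tm \<Sigma> \<Delta> \<Theta>' (fst q') (snd q')"
      using assms(1) unfolding valid_def by fastforce
    moreover from this have "eq_tm \<Sigma> (\<Delta> @ [(\<Theta>, p)]) \<Theta>' (fst q') (snd q')"
      by (auto intro: eq_mono(1))
    ultimately show ?thesis by blast
  next
    case 2
    then show ?thesis using assms(2,3) by blast
  qed
qed

section \<open>Derivability as a candidate for coinduction\<close>

text \<open>Closed under renaming by construction, and free in \<open>\<Delta>\<close> and
  \<open>\<Theta>\<close>, so that every premise met inside a derivation stays in the
  relation.\<close>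

definition derivable :: "tm \<Rightarrow> tm \<Rightarrow> bool" where
  "derivable M M' \<longleftrightarrow> (\<exists>\<Delta> \<Theta> \<sigma> N N'. valid \<Delta> \<and> eq_tm \<Sigma> \<Delta> \<Theta> N N' \<and>
     M = ren_tm \<sigma> N \<and> M' = ren_tm \<sigma> N')"

lemma derivable_ren: "derivable M M' \<Longrightarrow> derivable (ren_tm \<sigma> M) (ren_tm \<sigma> M')"
  unfolding derivable_def by (metis ren_comp(1))

lemma derivableI: "valid \<Delta> \<Longrightarrow> eq_tm \<Sigma> \<Delta> \<Theta> M M' \<Longrightarrow> derivable M M'"
  unfolding derivable_def by (metis ren_id(1))

inductive_cases eq_SNilE: "eq_spine \<Sigma> \<Delta> \<Theta> SNil S'"
inductive_cases eq_AppE: "eq_spine \<Sigma> \<Delta> \<Theta> (App M S) S'"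
inductive_cases eq_PAppE: "eq_spine \<Sigma> \<Delta> \<Theta> (PApp v S) S'"

lemma derivable_spineI: "valid \<Delta> \<Longrightarrow> eq_spine \<Sigma> \<Delta> \<Theta> S S' \<Longrightarrow> rel_spine derivable S S'"
  by (induct S arbitrary: S' rule: spine_induct)
    (auto elim!: eq_SNilE eq_AppE eq_PAppE intro: rel_spine.intros derivableI)

text \<open>Summed over a pair, this is the termination measure for exposing heads: it is at most 2
  and drops with each unfolding.\<close>

primrec nrec :: "tm \<Rightarrow> nat" where
  "nrec (Root H S) = (if is_rec H then 1 else 0)"
| "nrec (Lam M) = 0"

lemma nrec_ren [simp]: "nrec (ren_tm \<sigma> M) = nrec M"
  by (cases M) auto

lemma unfold_one_nrec: "unfold_one p q \<Longrightarrow> nrec (fst q) + nrec (snd q) < nrec (fst p) + nrec (snd p)"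
  unfolding unfold_one_def by (auto dest!: whn_result)

text \<open>The premises of \<open>bisim_Root\<close> with \<open>derivable\<close> in place of
  bisimilarity.\<close>

definition exposed :: "tm \<Rightarrow> tm \<Rightarrow> bool" where
  "exposed M M' \<longleftrightarrow>
    (\<exists>H S S'. whn \<Sigma> M (Root H S) \<and> whn \<Sigma> M' (Root H S') \<and> lc_head 0 H \<and> rel_spine derivable S S')"

lemma exposed_ren: "exposed M M' \<Longrightarrow> exposed (ren_tm \<sigma> M) (ren_tm \<sigma> M')"
  unfolding exposed_def using whn_ren rel_spine_ren[where R = derivable and R' = derivable] derivable_ren lc_head_ren by (metis ren_tm.simps(1))

lemma whn_whn: "whn \<Sigma> M P \<Longrightarrow> whn \<Sigma> P Q \<Longrightarrow> whn \<Sigma> M Q"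
  by (frule whn_result) (auto elim!: whn_RootE)

lemma exposed_unfold1: "unfold_one p q \<Longrightarrow> exposed (fst q) (snd q) \<Longrightarrow> exposed (fst p) (snd p)"
  unfolding unfold_one_def exposed_def using whn_whn by (elim disjE; clarsimp; metis)

text \<open>
  Each unfolding step, also one reached through an assumption, removes a recursive head, because
  the unfolded bodies are contractive.
\<close>

lemma derivable_exposed:
  assumes "valid \<Delta>" "eq_tm \<Sigma> \<Delta> \<Theta> (Root H S) (Root H' S')"
  shows "exposed (Root H S) (Root H' S')"
  using assms
proof (induct "nrec (Root H S) + nrec (Root H' S')" arbitrary: \<Delta> \<Theta> H S H' S' rule: less_induct)
  case less
  \<comment> \<open>Stated for any pair of the same measure, so that it serves both unfolding rules
    and an assumption, whose stored pair differs from the goal by a renaming.\<close>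
  have step: "exposed t t'" if v: "valid \<Delta>'" and u: "unfold_one (t, t') q"
    and e: "eq_tm \<Sigma> \<Delta>' \<Theta>' (fst q) (snd q)"
    and n: "nrec t + nrec t' = nrec (Root H S) + nrec (Root H' S')" for t t' q \<Delta>' \<Theta>'
  proof -
    have n': "nrec (fst q) + nrec (snd q) < nrec (Root H S) + nrec (Root H' S')"
      using unfold_one_nrec[OF u] n by simp
    obtain H1 S1 H1' S1' where q: "fst q = Root H1 S1" "snd q = Root H1' S1'"
      using u unfolding unfold_one_def by (auto dest!: whn_result)
    have "exposed (fst q) (snd q)"
      using less(1)[of H1 S1 H1' S1' \<Delta>' \<Theta>'] n' v e unfolding q by blast
    then show ?thesis using exposed_unfold1[OF u] by simp
  qed
  from less(3) show ?case
  proof (cases rule: eq_tm.cases)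
    case (eq_assm \<Theta>'' K T K' T' \<sigma>)
    obtain q where q: "unfold_one (Root K T, Root K' T') q" "eq_tm \<Sigma> \<Delta> \<Theta>'' (fst q) (snd q)"
      using less(2) eq_assm(3) unfolding valid_def by fastforce
    have "exposed (Root K T) (Root K' T')"
      by (rule step[OF less(2) q]) (use eq_assm in \<open>simp del: nrec.simps; metis nrec_ren\<close>)
    then show ?thesis using exposed_ren eq_assm(1,2) by metis
  next
    case (eq_unfold_left r A M P)
    have u: "unfold_one (Root H S, Root H' S') (P, Root H' S')"
      unfolding unfold_one_def using eq_unfold_left whn_unfold by fastforce
    show ?thesis
      by (rule step[OF _ u]) (use eq_unfold_left valid_snoc[OF less(2) u, of \<Theta>] in auto)
  next
    case (eq_unfold_right r A M P)
    have u: "unfold_one (Root H S, Root H' S') (Root H S, P)"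
      unfolding unfold_one_def using eq_unfold_right whn_unfold by fastforce
    show ?thesis
      by (rule step[OF _ u]) (use eq_unfold_right valid_snoc[OF less(2) u, of \<Theta>] in auto)
  next
    case (eq_const c)
    have "whn \<Sigma> (Root H S) (Root H S)" "whn \<Sigma> (Root H' S') (Root H S')" "lc_head 0 H"
      using eq_const whn_nonrec by auto
    then show ?thesis unfolding exposed_def
      using derivable_spineI[OF less(2) eq_const(3)] by blast
  next
    case (eq_var y)
    have "whn \<Sigma> (Root H S) (Root H S)" "whn \<Sigma> (Root H' S') (Root H S')" "lc_head 0 H"
      using eq_var whn_nonrec by auto
    then show ?thesis unfolding exposed_def
      using derivable_spineI[OF less(2) eq_var(3)] by blast
  qed
qed

text \<open>The empty assumption list is vacuously valid, so the pair lies in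
  \<open>derivable\<close>. That relation is a bisimulation up to renaming: pairs of roots are
  handled by \<open>derivable_exposed\<close>, pairs of abstractions by the premise of
  \<open>eq_Lam\<close>.\<close>

lemma eq_sound:
  assumes "eq_tm \<Sigma> [] \<Theta> M M'"
  shows "bisim \<Sigma> M M'"
proof -
  have "derivable M M'" using derivableI[OF _ assms] by (simp add: valid_def)
  then have "bisim \<Sigma> (ren_tm (\<lambda>x. x) M) (ren_tm (\<lambda>x. x) M')"
  proof (rule bisim_coinduct_up_to_ren)
    fix M M' assume "derivable M M'"
    then obtain \<Delta> \<Theta> \<sigma> N N' where v: "valid \<Delta>" "eq_tm \<Sigma> \<Delta> \<Theta> N N'"
      "M = ren_tm \<sigma> N" "M' = ren_tm \<sigma> N'" unfolding derivable_def by blast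
    show "(\<exists>H S S'. whn \<Sigma> M (Root H S) \<and> whn \<Sigma> M' (Root H S') \<and> lc_head 0 H \<and> rel_spine derivable S S') \<or>
      (\<exists>z N N'. M = Lam N \<and> M' = Lam N' \<and> z \<notin> fv_tm N \<union> fv_tm N' \<and>
         derivable (open_tm 0 z N) (open_tm 0 z N'))"
    proof (cases "\<exists>H S H' S'. N = Root H S \<and> N' = Root H' S'")
      case True
      then have "exposed N N'" using derivable_exposed[OF v(1)] v(2) by blast
      then have "exposed M M'" using exposed_ren v(3,4) by simp
      then show ?thesis unfolding exposed_def by (rule disjI1)
    next
      case False
      with v(2) obtain z K K' where K: "N = Lam K" "N' = Lam K'" "z \<notin> fv_tm K \<union> fv_tm K'"
        "eq_tm \<Sigma> \<Delta> (finsert z \<Theta>) (open_tm 0 z K) (open_tm 0 z K')"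
        by (cases rule: eq_tm.cases) auto
      obtain w where w: "w \<notin> fv_tm (ren_tm \<sigma> K) \<union> fv_tm (ren_tm \<sigma> K')"
        by (rule fresh_name[of "fv_tm (ren_tm \<sigma> K) \<union> fv_tm (ren_tm \<sigma> K')"]) auto
      have "derivable (ren_tm (\<sigma>(z := w)) (open_tm 0 z K)) (ren_tm (\<sigma>(z := w)) (open_tm 0 z K'))"
        unfolding derivable_def using v(1) K(4) by blast
      then have "derivable (open_tm 0 w (ren_tm \<sigma> K)) (open_tm 0 w (ren_tm \<sigma> K'))"
        using K(3) by (simp add: ren_upd_open)
      then show ?thesis using w v(3,4) K(1,2) by auto
    qed
  qed
  then show ?thesis by simp
qed

end

subsection \<open>Compatibility\<close>

context colf begin

lemma bisim_RootD:
  assumes "bisim \<Sigma> (Root H S) M'"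
  obtains H' S' K T T' where "M' = Root H' S'" "whn \<Sigma> (Root H S) (Root K T)"
    "whn \<Sigma> (Root H' S') (Root K T')" "rel_spine (bisim \<Sigma>) T T'"
proof -
  obtain K T T' where k: "whn \<Sigma> (Root H S) (Root K T)" "whn \<Sigma> M' (Root K T')" "rel_spine (bisim \<Sigma>) T T'"
    using assms by (auto elim: bisim_RootE)
  moreover obtain H' S' where "M' = Root H' S'" using k(2) by (cases M') auto
  ultimately show ?thesis using that by blast
qed

lemma whn_nonrec_eq: "whn \<Sigma> (Root H S) P \<Longrightarrow> \<not> is_rec H \<Longrightarrow> P = Root H S"
  by (auto elim: whn_RootE)

lemma whn_rec_prepat: "whn \<Sigma> (Root H S) P \<Longrightarrow> is_rec H \<Longrightarrow> prepat S"
  by (auto elim: whn_RootE)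

lemma hsubst_rec:
  assumes "hsubst \<tau> N x (Root H S) P" "is_rec H" "prepat S"
  shows "P = Root H S" "x \<notin> fv_tm (Root H S)"
proof -
  have h: "H \<noteq> Var (Free x)" using assms(2) by auto
  then obtain S' where "P = Root H S'" "hsubst_spine \<tau> N x S S'"
    using assms(1) by (auto elim: hsubst_RootE)
  then show "P = Root H S" "x \<notin> fv_tm (Root H S)"
    using hsubst_prepat_id[OF assms(3)] h by (auto simp: mem_fv_head)
qed

text \<open>Bisimilar terms may have different free variables, since an unfolding can discard
  arguments. But an occurrence of \<open>x\<close> that substitution replaces is a head visible in
  the infinite tree, and \<open>L\<close> would contain it too. At recursion constants the spine is
  prepattern and substitution is the identity.\<close>

lemma hsubst_vacuous:
  "hsubst \<tau> N x M P \<Longrightarrow> bisim \<Sigma> L M \<Longrightarrow> x \<notin> fv_tm L \<Longrightarrow> P = M"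
  "hsubst_spine \<tau> N x S S' \<Longrightarrow> rel_spine (bisim \<Sigma>) T S \<Longrightarrow> x \<notin> fv_spine T \<Longrightarrow> S' = S"
  "hreduce \<tau> S N P \<Longrightarrow> True"
proof (induct arbitrary: L and T rule: hsubst_hsubst_spine_hreduce.inducts)
  case (hsubst_Lam z x N M P \<tau>)
  obtain K where K: "L = Lam K" "\<And>z. bisim \<Sigma> (open_tm 0 z M) (open_tm 0 z K)"
    using bisim_LamD[OF bisim_sym[OF hsubst_Lam(4)]] by blast
  have "x \<notin> fv_tm (open_tm 0 z K)"
    using fv_open_upper(1)[of 0 z K] hsubst_Lam(1,5) K(1) by auto
  then have "open_tm 0 z P = open_tm 0 z M" using hsubst_Lam(3) bisim_sym[OF K(2)] by blast
  then have "P = M" by (rule open_inj(1)[rotated 2]) (use hsubst_Lam(1) in auto)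
  then show ?case by simp
next
  case (hsubst_Root_same \<tau> N x S S' P)
  obtain K T T' where L: "whn \<Sigma> L (Root K T')" "whn \<Sigma> (Root (Var (Free x)) S) (Root K T)"
    using hsubst_Root_same(5) by (auto elim!: bisim_Root_rightE)
  have "x \<in> fv_tm (Root K T')" using whn_nonrec_eq[OF L(2)] by simp
  then show ?case using fv_whn[OF L(1)] hsubst_Root_same(6) by auto
next
  case (hsubst_Root_other H x \<tau> N S S')
  obtain K T T' where L: "whn \<Sigma> L (Root K T')" "whn \<Sigma> (Root H S) (Root K T)"
    "rel_spine (bisim \<Sigma>) T' T"
    using hsubst_Root_other(4) by (auto elim!: bisim_Root_rightE)
  show ?case
  proof (cases "is_rec H")
    case True
    then show ?thesis using hsubst_prepat_id[OF whn_rec_prepat[OF L(2)] hsubst_Root_other(2)] by simp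
  next
    case False
    then have "K = H" "T = S" using whn_nonrec_eq[OF L(2)] by auto
    moreover have "x \<notin> fv_spine T'" using fv_whn[OF L(1)] hsubst_Root_other(5) by auto
    ultimately show ?thesis using hsubst_Root_other(3) L(3) by simp
  qed
next
  case (hsubst_App \<tau> N x M M' S S')
  from hsubst_App(5) show ?case
    by (cases rule: rel_spine.cases) (use hsubst_App in auto)
next
  case (hsubst_PApp v x \<tau> N S S')
  from hsubst_PApp(4) show ?case
    by (cases rule: rel_spine.cases) (use hsubst_PApp in auto)
qed auto

text \<open>
  The renaming \<open>\<sigma>\<close> strengthens the induction: it lets the fresh name of a binder in the first
  derivation be replaced by one that is also fresh for the second.
\<close>

lemma hsubst_bisim:
  "hsubst \<tau> N x M P \<Longrightarrow> (\<And>y. y \<in> fv_tm M \<Longrightarrow> \<sigma> y = \<sigma> x \<Longrightarrow> y = x) \<Longrightarrow>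
    bisim \<Sigma> (ren_tm \<sigma> N) N' \<Longrightarrow> bisim \<Sigma> (ren_tm \<sigma> M) M' \<Longrightarrow> hsubst \<tau> N' (\<sigma> x) M' P' \<Longrightarrow>
    bisim \<Sigma> (ren_tm \<sigma> P) P'"
  "hsubst_spine \<tau> N x S T \<Longrightarrow> (\<And>y. y \<in> fv_spine S \<Longrightarrow> \<sigma> y = \<sigma> x \<Longrightarrow> y = x) \<Longrightarrow>
    bisim \<Sigma> (ren_tm \<sigma> N) N' \<Longrightarrow> rel_spine (bisim \<Sigma>) (ren_spine \<sigma> S) S' \<Longrightarrow> hsubst_spine \<tau> N' (\<sigma> x) S' T' \<Longrightarrow>
    rel_spine (bisim \<Sigma>) (ren_spine \<sigma> T) T'"
  "hreduce \<tau> S N P \<Longrightarrow> rel_spine (bisim \<Sigma>) (ren_spine \<sigma> S) S' \<Longrightarrow> bisim \<Sigma> (ren_tm \<sigma> N) N' \<Longrightarrow>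
    hreduce \<tau> S' N' P' \<Longrightarrow> bisim \<Sigma> (ren_tm \<sigma> P) P'"
proof (induct arbitrary: \<sigma> N' M' P' and \<sigma> N' S' T' and \<sigma> S' N' P' rule: hsubst_hsubst_spine_hreduce.inducts)
  case (hsubst_Lam z x N M P \<tau>)
  obtain K where K: "M' = Lam K" "\<And>z. bisim \<Sigma> (open_tm 0 z (ren_tm \<sigma> M)) (open_tm 0 z K)"
    using bisim_LamD[OF hsubst_Lam(6)[unfolded ren_tm.simps]] by blast
  obtain z' Q where Q: "P' = Lam Q" "z' \<notin> {\<sigma> x} \<union> fv_tm N' \<union> fv_tm K \<union> fv_tm Q"
    "hsubst \<tau> N' (\<sigma> x) (open_tm 0 z' K) (open_tm 0 z' Q)"
    using hsubst_Lam(7) unfolding K(1) by (auto elim: hsubst_LamE)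
  \<comment> \<open>\<open>w\<close> avoids \<open>\<sigma> x\<close>, so moving either binder name
    to \<open>w\<close> creates no new occurrence of the substituted variable; it avoids both result
    bodies because it becomes the witness for \<open>bisim_Lam\<close>.\<close>
  let ?X = "{\<sigma> x} \<union> fv_tm (ren_tm \<sigma> P) \<union> fv_tm Q"
  obtain w where w: "w \<notin> ?X"
    by (rule fresh_name[of ?X]) auto
  have z: "z \<noteq> x" "z \<notin> fv_tm N" "z \<notin> fv_tm M" "z \<notin> fv_tm P" using hsubst_Lam(1) by auto
  have "hsubst \<tau> (ren_tm ((\<lambda>x. x)(z' := w)) N') (((\<lambda>x. x)(z' := w)) (\<sigma> x))
      (ren_tm ((\<lambda>x. x)(z' := w)) (open_tm 0 z' K)) (ren_tm ((\<lambda>x. x)(z' := w)) (open_tm 0 z' Q))"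
    by (rule ren_hsubst(1)[OF Q(3)]) (use Q(2) w in \<open>auto split: if_splits\<close>)
  then have 1: "hsubst \<tau> N' (\<sigma> x) (open_tm 0 w K) (open_tm 0 w Q)"
    using Q(2) by (simp add: rename_open ren_upd_fresh)
  have "bisim \<Sigma> (ren_tm (\<sigma>(z := w)) (open_tm 0 z P)) (open_tm 0 w Q)"
  proof (rule hsubst_Lam(3))
    fix y assume "y \<in> fv_tm (open_tm 0 z M)" "(\<sigma>(z := w)) y = (\<sigma>(z := w)) x"
    then show "y = x" using fv_open_upper(1)[of 0 z M] hsubst_Lam(4)[of y] w z
      by (auto split: if_splits)
  next
    show "bisim \<Sigma> (ren_tm (\<sigma>(z := w)) N) N'" using hsubst_Lam(5) z by (simp add: ren_upd_fresh)
    show "bisim \<Sigma> (ren_tm (\<sigma>(z := w)) (open_tm 0 z M)) (open_tm 0 w K)"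
      using K(2) z by (simp add: ren_upd_open)
    show "hsubst \<tau> N' ((\<sigma>(z := w)) x) (open_tm 0 w K) (open_tm 0 w Q)" using 1 z by simp
  qed
  then have "bisim \<Sigma> (open_tm 0 w (ren_tm \<sigma> P)) (open_tm 0 w Q)" using z by (simp add: ren_upd_open)
  then show ?case using w Q(1) by (simp add: bisim_Lam[of w])
next
  case (hsubst_Root_same \<tau> N x S S0 P)
  obtain H' U K T T' where M': "M' = Root H' U" "whn \<Sigma> (Root (Var (Free (\<sigma> x))) (ren_spine \<sigma> S)) (Root K T)"
    "whn \<Sigma> (Root H' U) (Root K T')" "rel_spine (bisim \<Sigma>) T T'"
    using bisim_RootD[OF hsubst_Root_same(7)[unfolded ren_tm.simps ren_head.simps ren_var.simps]] by blast
  have KT: "K = Var (Free (\<sigma> x))" "T = ren_spine \<sigma> S" using whn_nonrec_eq[OF M'(2)] by auto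
  \<comment> \<open>With a recursion constant on the right, definedness of substitution would
    exclude \<open>\<sigma> x\<close> from the term and hence from its unfolding, whose head is
    \<open>\<sigma> x\<close>.\<close>
  have "\<not> is_rec H'"
  proof
    assume r: "is_rec H'"
    have "\<sigma> x \<notin> fv_tm (Root H' U)"
      using hsubst_rec(2)[OF _ r whn_rec_prepat[OF M'(3) r]] hsubst_Root_same(8) M'(1) by blast
    then show False using fv_whn[OF M'(3)] KT by auto
  qed
  then have "H' = Var (Free (\<sigma> x))" "U = T'" using whn_nonrec_eq[OF M'(3)] KT by auto
  then obtain U' where U': "hsubst_spine \<tau> N' (\<sigma> x) T' U'" "hreduce \<tau> U' N' P'"
    using hsubst_Root_same(8) M'(1) by (auto elim: hsubst_RootE)
  have "rel_spine (bisim \<Sigma>) (ren_spine \<sigma> S0) U'"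
    using hsubst_Root_same(2)[OF _ hsubst_Root_same(6) _ U'(1)] hsubst_Root_same(5) M'(4) KT(2)
    by auto
  then show ?case using hsubst_Root_same(4)[OF _ hsubst_Root_same(6) U'(2)] by blast
next
  case (hsubst_Root_other H x \<tau> N S S0)
  obtain H' U K T T' where M': "M' = Root H' U"
    "whn \<Sigma> (Root (ren_head \<sigma> H) (ren_spine \<sigma> S)) (Root K T)"
    "whn \<Sigma> (Root H' U) (Root K T')" "rel_spine (bisim \<Sigma>) T T'"
    using bisim_RootD[OF hsubst_Root_other(6)[unfolded ren_tm.simps]] by blast
  have sub: "hsubst \<tau> (ren_tm \<sigma> N) (\<sigma> x) (ren_tm \<sigma> (Root H S)) (ren_tm \<sigma> (Root H S0))"
    by (rule ren_hsubst(1)[OF hsubst_hsubst_spine_hreduce.hsubst_Root_other[OF hsubst_Root_other(1,2)]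
        hsubst_Root_other(4)])
  \<comment> \<open>A recursive head on either side makes both substitutions the identity: on that
    side by \<open>hsubst_rec\<close>, which also gives absence of \<open>\<sigma> x\<close>, and on
    the other by \<open>hsubst_vacuous\<close>.\<close>
  consider "is_rec H" | "is_rec H'" | "\<not> is_rec H" "\<not> is_rec H'" by blast
  then show ?case
  proof cases
    case 1
    then have "prepat (ren_spine \<sigma> S)" using whn_rec_prepat[OF M'(2)] by simp
    then have *: "ren_tm \<sigma> (Root H S0) = ren_tm \<sigma> (Root H S)" "\<sigma> x \<notin> fv_tm (ren_tm \<sigma> (Root H S))"
      using hsubst_rec[of \<tau> "ren_tm \<sigma> N" "\<sigma> x" "ren_head \<sigma> H" "ren_spine \<sigma> S"] sub 1 by auto
    then have "P' = M'" using hsubst_vacuous(1)[OF hsubst_Root_other(7,6)] by blast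
    then show ?thesis using *(1) hsubst_Root_other(6) by simp
  next
    case 2
    have *: "P' = M'" "\<sigma> x \<notin> fv_tm M'"
      using hsubst_rec[OF _ 2 whn_rec_prepat[OF M'(3) 2]] hsubst_Root_other(7) M'(1) by blast+
    then have "ren_tm \<sigma> (Root H S0) = ren_tm \<sigma> (Root H S)"
      using hsubst_vacuous(1)[OF sub bisim_sym[OF hsubst_Root_other(6)]] by blast
    then show ?thesis using *(1) hsubst_Root_other(6) by simp
  next
    case 3
    have KT: "K = ren_head \<sigma> H" "T = ren_spine \<sigma> S" "H' = ren_head \<sigma> H" "U = T'"
      using whn_nonrec_eq[OF M'(2)] whn_nonrec_eq[OF M'(3)] 3 by auto
    have "ren_head \<sigma> H \<noteq> Var (Free (\<sigma> x))"
    proof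
      assume "ren_head \<sigma> H = Var (Free (\<sigma> x))"
      then have "\<sigma> x \<in> fv_head (ren_head \<sigma> H)" by (simp add: mem_fv_head)
      then obtain y where "y \<in> fv_head H" "\<sigma> y = \<sigma> x" by auto
      then show False using hsubst_Root_other(1) hsubst_Root_other(4)[of y] by (auto simp: mem_fv_head)
    qed
    then obtain U' where U': "P' = Root H' U'" "hsubst_spine \<tau> N' (\<sigma> x) U U'"
      using hsubst_Root_other(7) KT(3) M'(1) by (auto elim: hsubst_RootE)
    have "rel_spine (bisim \<Sigma>) (ren_spine \<sigma> S0) U'"
      using hsubst_Root_other(3)[OF _ hsubst_Root_other(5) _ U'(2)] hsubst_Root_other(4) M'(4) KT
      by auto
    moreover have "lc_head 0 (ren_head \<sigma> H)"
      using hsubst_Root_other(6) 3 by (auto elim!: bisim_RootE dest: whn_nonrec_eq)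
    moreover have "\<not> is_rec (ren_head \<sigma> H)" using 3 by simp
    ultimately have "bisim \<Sigma> (Root (ren_head \<sigma> H) (ren_spine \<sigma> S0)) (Root (ren_head \<sigma> H) U')"
      by (blast intro: bisim_Root whn_nonrec)
    then show ?thesis using U'(1) KT by simp
  qed
next
  case (hsubst_SNil \<tau> N x)
  then show ?case by (auto elim!: rel_spine_SNilE hsubst_SNilE intro: rel_spine.intros)
next
  case (hsubst_App \<tau> N x M M0 S S0)
  from hsubst_App(7) obtain K U where S': "S' = App K U" "bisim \<Sigma> (ren_tm \<sigma> M) K"
    "rel_spine (bisim \<Sigma>) (ren_spine \<sigma> S) U" by (auto elim: rel_spine_AppE)
  with hsubst_App(8) obtain K' U' where "T' = App K' U'" "hsubst \<tau> N' (\<sigma> x) K K'"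
    "hsubst_spine \<tau> N' (\<sigma> x) U U'" by (auto elim: hsubst_AppE)
  then show ?case
    using hsubst_App(2)[OF _ hsubst_App(6) S'(2)] hsubst_App(4)[OF _ hsubst_App(6) S'(3)] hsubst_App(5)
    by (auto intro!: rel_spine_App)
next
  case (hsubst_PApp v x \<tau> N S S0)
  from hsubst_PApp(6) obtain y U where S': "ren_var \<sigma> v = Free y" "S' = PApp (Free y) U"
    "rel_spine (bisim \<Sigma>) (ren_spine \<sigma> S) U" by (auto elim: rel_spine_PAppE)
  with hsubst_PApp(7) obtain U' where "T' = PApp (Free y) U'" "hsubst_spine \<tau> N' (\<sigma> x) U U'"
    by (auto elim: hsubst_PAppE)
  then show ?case
    using hsubst_PApp(3)[OF _ hsubst_PApp(5) S'(3)] hsubst_PApp(4) S'(1)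
    by (auto intro!: rel_spine_PApp)
next
  case (hreduce_SNil H S)
  then show ?case by (auto elim!: rel_spine_SNilE hreduce_SNilE)
next
  case (hreduce_App z N M \<tau>2 Q \<tau>1 S P)
  obtain L U where S': "S' = App L U" "bisim \<Sigma> (ren_tm \<sigma> N) L" "rel_spine (bisim \<Sigma>) (ren_spine \<sigma> S) U"
    using hreduce_App(6) by (auto elim: rel_spine_AppE)
  obtain K where K: "N' = Lam K" "\<And>z. bisim \<Sigma> (open_tm 0 z (ren_tm \<sigma> M)) (open_tm 0 z K)"
    using bisim_LamD[OF hreduce_App(7)[unfolded ren_tm.simps]] by blast
  obtain z' Q' where Q: "z' \<notin> fv_tm L \<union> fv_tm K" "hsubst \<tau>2 L z' (open_tm 0 z' K) Q'"
    "hreduce \<tau>1 U Q' P'"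
    using hreduce_App(8) unfolding S' K(1) by (auto elim: hreduce_AppE)
  \<comment> \<open>Here the binder name is itself the substituted variable, so \<open>w\<close>
    must not coincide with another free variable of either body. The results contain neither
    \<open>z\<close> nor \<open>z'\<close> and are unaffected.\<close>
  let ?X = "fv_tm (ren_tm \<sigma> M) \<union> fv_tm K"
  obtain w where w: "w \<notin> ?X"
    by (rule fresh_name[of ?X]) auto
  have z: "z \<notin> fv_tm N" "z \<notin> fv_tm M" using hreduce_App(1) by auto
  have zQ: "z \<notin> fv_tm Q" using fv_hsubst(1)[OF hreduce_App(2)] z by auto
  have zQ': "z' \<notin> fv_tm Q'" using fv_hsubst(1)[OF Q(2)] Q(1) by auto
  have "hsubst \<tau>2 (ren_tm ((\<lambda>x. x)(z' := w)) L) (((\<lambda>x. x)(z' := w)) z')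
      (ren_tm ((\<lambda>x. x)(z' := w)) (open_tm 0 z' K)) (ren_tm ((\<lambda>x. x)(z' := w)) Q')"
    by (rule ren_hsubst(1)[OF Q(2)])
      (use w fv_open_upper(1)[of 0 z' K] in \<open>auto split: if_splits\<close>)
  then have 1: "hsubst \<tau>2 L w (open_tm 0 w K) Q'"
    using Q(1) zQ' by (simp add: rename_open ren_upd_fresh)
  have "bisim \<Sigma> (ren_tm (\<sigma>(z := w)) Q) Q'"
  proof (rule hreduce_App(3))
    fix y assume "y \<in> fv_tm (open_tm 0 z M)" "(\<sigma>(z := w)) y = (\<sigma>(z := w)) z"
    then show "y = z" using fv_open_upper(1)[of 0 z M] w by (auto split: if_splits)
  next
    show "bisim \<Sigma> (ren_tm (\<sigma>(z := w)) N) L" using S'(2) z by (simp add: ren_upd_fresh)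
    show "bisim \<Sigma> (ren_tm (\<sigma>(z := w)) (open_tm 0 z M)) (open_tm 0 w K)"
      using K(2) z by (simp add: ren_upd_open)
    show "hsubst \<tau>2 L ((\<sigma>(z := w)) z) (open_tm 0 w K) Q'" using 1 by simp
  qed
  then have "bisim \<Sigma> (ren_tm \<sigma> Q) Q'" using zQ by (simp add: ren_upd_fresh)
  then show ?case using hreduce_App(5)[OF S'(3) _ Q(3)] by blast
next
  case (hreduce_PApp \<tau>1 S y M P)
  obtain U where S': "S' = PApp (Free (\<sigma> y)) U" "rel_spine (bisim \<Sigma>) (ren_spine \<sigma> S) U"
    using hreduce_PApp(3) by (auto elim: rel_spine_PAppE)
  obtain K where K: "N' = Lam K" "\<And>z. bisim \<Sigma> (open_tm 0 z (ren_tm \<sigma> M)) (open_tm 0 z K)"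
    using bisim_LamD[OF hreduce_PApp(4)[unfolded ren_tm.simps]] by blast
  have "hreduce \<tau>1 U (open_tm 0 (\<sigma> y) K) P'"
    using hreduce_PApp(5) unfolding S' K(1) by (auto elim: hreduce_PAppE)
  \<comment> \<open>The argument may already occur in the bodies, so bisimilarity is used at an
    arbitrary opening name and not at a fresh one.\<close>
  moreover have "bisim \<Sigma> (ren_tm \<sigma> (open_tm 0 y M)) (open_tm 0 (\<sigma> y) K)"
    using K(2) by (simp add: ren_open)
  ultimately show ?case using hreduce_PApp(2)[OF S'(2)] by blast
qed

end

subsection \<open>Completeness\<close>

primrec tsize :: "tm \<Rightarrow> nat" and ssize :: "spine \<Rightarrow> nat" where
  "tsize (Root H S) = Suc (ssize S)"
| "tsize (Lam M) = Suc (tsize M)"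
| "ssize SNil = 0"
| "ssize (App M S) = Suc (tsize M + ssize S)"
| "ssize (PApp v S) = Suc (ssize S)"

text \<open>The vocabulary of a term: prepattern variables are recorded as heads and indices count
  as symbols, so that a finite vocabulary and a size bound leave finitely many terms.\<close>

primrec syms_tm :: "tm \<Rightarrow> head set" and syms_spine :: "spine \<Rightarrow> head set" where
  "syms_tm (Root H S) = insert H (syms_spine S)"
| "syms_tm (Lam M) = syms_tm M"
| "syms_spine SNil = {}"
| "syms_spine (App M S) = syms_tm M \<union> syms_spine S"
| "syms_spine (PApp v S) = insert (Var v) (syms_spine S)"

abbreviation FreeVar :: "name \<Rightarrow> head" where
  "FreeVar x \<equiv> Var (Free x)"

lemma size_ren [simp]: "tsize (ren_tm \<sigma> M) = tsize M" "ssize (ren_spine \<sigma> S) = ssize S"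
  by (induct M and S rule: tm.induct spine.induct) auto

lemma size_open [simp]: "tsize (open_tm k z M) = tsize M" "ssize (open_spine k z S) = ssize S"
  by (induct M and S arbitrary: k and k rule: tm.induct spine.induct) auto

lemma finite_syms [simp]: "finite (syms_tm M)" "finite (syms_spine S)"
  by (induct M and S rule: tm.induct spine.induct) auto

lemma syms_ren:
  "syms_tm (ren_tm \<sigma> M) = ren_head \<sigma> ` syms_tm M"
  "syms_spine (ren_spine \<sigma> S) = ren_head \<sigma> ` syms_spine S"
  by (induct M and S rule: tm.induct spine.induct) auto

lemma open_head_cases: "open_head k z H = FreeVar z \<or> open_head k z H = H"
proof (cases H)
  case (Var v) then show ?thesis by (cases v) auto
qed auto

lemma syms_open:
  "syms_tm (open_tm k z M) \<subseteq> insert (FreeVar z) (syms_tm M)"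
  "syms_spine (open_spine k z S) \<subseteq> insert (FreeVar z) (syms_spine S)"
proof (induct M and S arbitrary: k and k rule: tm.induct spine.induct)
  case (Root H S)
  then show ?case using open_head_cases[of k z H] by fastforce
next
  case (PApp v S)
  then show ?case using open_head_cases[of k z "Var v"] by fastforce
qed fastforce+

lemma fv_syms:
  "fv_tm M = \<Union> (fv_head ` syms_tm M)"
  "fv_spine S = \<Union> (fv_head ` syms_spine S)"
  by (induct M and S rule: tm.induct spine.induct) auto

text \<open>Each variable occurrence costs at least one unit of size. This bounds the number of pool
  names that a pair can require.\<close>

lemma card_fv: "card (fv_tm M) \<le> tsize M" "card (fv_spine S) \<le> ssize S"
proof (induct M and S rule: tm.induct spine.induct)
  case (Root H S)
  have "card (fv_head H) \<le> 1"
  proof (cases H)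
    case (Var v) then show ?thesis by (cases v) auto
  qed auto
  then show ?case using Root card_Un_le[of "fv_head H" "fv_spine S"] by simp
next
  case (App M S)
  then show ?case using card_Un_le[of "fv_tm M" "fv_spine S"] by simp
next
  case (PApp v S)
  have "card (fv_var v) \<le> 1" by (cases v) auto
  then show ?case using PApp card_Un_le[of "fv_var v" "fv_spine S"] by simp
qed auto

lemma finite_bounded_size:
  assumes "finite A"
  shows "finite {M. tsize M \<le> n \<and> syms_tm M \<subseteq> A}" "finite {S. ssize S \<le> n \<and> syms_spine S \<subseteq> A}"
proof (induct n)
  case 0
  { case 1
    have "0 < tsize M" for M by (cases M) auto
    then have "{M. tsize M \<le> 0 \<and> syms_tm M \<subseteq> A} = {}" by (auto simp: not_le)
    then show ?case by (simp only: finite.emptyI) }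
  { case 2
    have "S = SNil" if "ssize S = 0" for S using that by (cases S) auto
    then have "{S. ssize S \<le> 0 \<and> syms_spine S \<subseteq> A} \<subseteq> {SNil}" by auto
    then show ?case by (rule finite_subset) simp }
next
  case (Suc n)
  let ?T = "\<lambda>n. {M. tsize M \<le> n \<and> syms_tm M \<subseteq> A}"
  let ?S = "\<lambda>n. {S. ssize S \<le> n \<and> syms_spine S \<subseteq> A}"
  let ?V = "Var -` A"
  have V: "finite ?V" using assms by (intro finite_vimageI injI) auto
  { case 1
    have "M \<in> (\<lambda>(H, S). Root H S) ` (A \<times> ?S n) \<union> Lam ` ?T n" if "M \<in> ?T (Suc n)" for M
      using that by (cases M) auto
    then have "?T (Suc n) \<subseteq> (\<lambda>(H, S). Root H S) ` (A \<times> ?S n) \<union> Lam ` ?T n" by blast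
    then show ?case by (rule finite_subset) (use Suc assms in auto) }
  { case 2
    have "S \<in> {SNil} \<union> (\<lambda>(M, S). App M S) ` (?T n \<times> ?S n) \<union> (\<lambda>(v, S). PApp v S) ` (?V \<times> ?S n)"
      if "S \<in> ?S (Suc n)" for S
      using that by (cases S) auto
    then have "?S (Suc n) \<subseteq> {SNil} \<union> (\<lambda>(M, S). App M S) ` (?T n \<times> ?S n) \<union> (\<lambda>(v, S). PApp v S) ` (?V \<times> ?S n)"
      by blast
    then show ?case by (rule finite_subset) (use Suc V in auto) }
qed

text \<open>Names replace leading binders, so an unfolding is no larger than the definition body,
  whatever the spine; this is why the search stays among terms of bounded size.\<close>

lemma hreduce_prepat_bounds:
  "prepat S \<Longrightarrow> hreduce \<tau> S M P \<Longrightarrow>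
    tsize P \<le> tsize M \<and> syms_tm P \<subseteq> syms_tm M \<union> FreeVar ` fv_spine S"
proof (induct S arbitrary: \<tau> M rule: spine_induct)
  case (3 v S)
  then obtain \<tau>' y K where K: "v = Free y" "M = Lam K" "hreduce \<tau>' S (open_tm 0 y K) P"
    by (auto elim!: hreduce_PAppE)
  then show ?case using 3(1)[OF _ K(3)] 3(2) syms_open(1)[of 0 y K] by auto
qed (auto elim!: hreduce_SNilE)

section \<open>Search over a finite pool of names\<close>

text \<open>\<open>C\<close> collects the symbols without free variables and \<open>n\<close> bounds
  the definition bodies and all terms of the search. Two terms of size at most \<open>n\<close> have
  at most \<open>2 * n\<close> free variables, which fixes the size of the pool
  \<open>B\<close>.\<close>

locale bounded = colf +
  fixes F B :: "name set" and C :: "head set" and n :: nat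
  assumes finF: "finite F" and finB: "finite B" and finC: "finite C"
    and closedC: "\<And>H. H \<in> C \<Longrightarrow> fv_head H = {}"
    and disj: "F \<inter> B = {}" and cardB: "2 * n \<le> card B"
    and bodies: "\<And>r A M. RecDef r A M \<in> set \<Sigma> \<Longrightarrow> tsize M \<le> n \<and> syms_tm M \<subseteq> C"
begin

definition within :: "name set \<Rightarrow> tm \<Rightarrow> bool" where
  "within X M \<longleftrightarrow> tsize M \<le> n \<and> syms_tm M \<subseteq> C \<union> FreeVar ` X"

lemma within_fv: "within X M \<Longrightarrow> fv_tm M \<subseteq> X"
  unfolding within_def fv_syms using closedC by fastforce

lemma within_ren:
  assumes "within X M" "\<And>x. x \<in> fv_tm M \<Longrightarrow> \<kappa> x \<in> Y"
  shows "within Y (ren_tm \<kappa> M)"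
proof -
  have "ren_head \<kappa> H \<in> C \<union> FreeVar ` Y" if H: "H \<in> syms_tm M" for H
  proof (cases "H \<in> C")
    case True
    then have "ren_head \<kappa> H = ren_head (\<lambda>x. x) H" using closedC by (intro ren_head_cong) auto
    then show ?thesis using True by simp
  next
    case False
    then obtain x where x: "H = FreeVar x" using assms(1) H unfolding within_def by blast
    then have "x \<in> fv_tm M" using H unfolding fv_syms by force
    then show ?thesis using assms(2) x by simp
  qed
  then show ?thesis using assms(1) unfolding within_def syms_ren by auto
qed

text \<open>
  \<open>F\<close> holds the free variables that no renaming of an assumption may move; the others are
  renamed injectively into the pool \<open>B\<close>, which puts a pair into one of finitely many forms.
\<close>

definition canon :: "(name \<Rightarrow> name) \<Rightarrow> tm \<Rightarrow> tm \<Rightarrow> bool" where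
  "canon \<kappa> t t' \<longleftrightarrow> inj_on \<kappa> (fv_tm t \<union> fv_tm t') \<and> (\<forall>x\<in>F. \<kappa> x = x) \<and>
     (\<forall>x\<in>fv_tm t \<union> fv_tm t' - F. \<kappa> x \<in> B)"

definition pairs :: "(tm \<times> tm) set" where
  "pairs = {(t, t'). within (F \<union> B) t \<and> within (F \<union> B) t'}"

definition realized :: "assm list \<Rightarrow> tm \<times> tm \<Rightarrow> bool" where
  "realized \<Delta> c \<longleftrightarrow>
    (\<exists>\<Theta> t t' \<kappa>. (\<Theta>, t, t') \<in> set \<Delta> \<and> canon \<kappa> t t' \<and> c = (ren_tm \<kappa> t, ren_tm \<kappa> t'))"

text \<open>The canonical pairs that no stored assumption covers yet; their number is the outer
  termination measure.\<close>

definition todo :: "assm list \<Rightarrow> (tm \<times> tm) set" where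
  "todo \<Delta> = {c \<in> pairs. \<not> realized \<Delta> c}"

lemma finite_todo: "finite (todo \<Delta>)"
proof -
  have "finite {M. within (F \<union> B) M}"
    unfolding within_def using finF finB finC by (intro finite_bounded_size(1)) auto
  then have "finite ({M. within (F \<union> B) M} \<times> {M. within (F \<union> B) M})" by blast
  then show ?thesis by (rule rev_finite_subset) (auto simp: todo_def pairs_def)
qed

lemma canon_exists:
  assumes "within X t" "within X t'"
  obtains \<kappa> where "canon \<kappa> t t'"
proof -
  let ?V = "fv_tm t \<union> fv_tm t'"
  have "card (?V - F) \<le> card ?V" by (intro card_mono) auto
  also have "\<dots> \<le> card (fv_tm t) + card (fv_tm t')" by (rule card_Un_le)
  also have "\<dots> \<le> 2 * n" using card_fv(1)[of t] card_fv(1)[of t'] assms unfolding within_def by simp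
  also note cardB
  finally obtain f where f: "f ` (?V - F) \<subseteq> B" "inj_on f (?V - F)"
    using card_le_inj[of "?V - F" B] finB by auto
  have "canon (\<lambda>x. if x \<in> ?V - F then f x else x) t t'"
    unfolding canon_def
  proof (intro conjI inj_onI)
    fix x y assume xy: "x \<in> ?V" "y \<in> ?V"
      "(if x \<in> ?V - F then f x else x) = (if y \<in> ?V - F then f y else y)"
    consider "x \<in> F" "y \<in> F" | "x \<in> F" "y \<notin> F" | "x \<notin> F" "y \<in> F" | "x \<notin> F" "y \<notin> F" by blast
    then show "x = y"
    proof cases
      case 2 then show ?thesis using xy f(1) disj by auto
    next
      case 3 then show ?thesis using xy f(1) disj by auto
    next
      case 4 then show ?thesis using xy inj_onD[OF f(2), of x y] by simp
    qed (use xy in auto)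
  qed (use f(1) in auto)
  then show ?thesis by (rule that)
qed

lemma canon_pairs:
  assumes "within X t" "within X t'" "canon \<kappa> t t'"
  shows "(ren_tm \<kappa> t, ren_tm \<kappa> t') \<in> pairs"
proof -
  have "\<kappa> x \<in> F \<union> B" if "x \<in> fv_tm t \<union> fv_tm t'" for x
    using assms(3) that unfolding canon_def by (cases "x \<in> F") auto
  then show ?thesis unfolding pairs_def using within_ren assms by auto
qed

text \<open>The renaming is the inverse of \<open>\<kappa>\<close> after \<open>\<kappa>'\<close>.
  Both maps fix \<open>F\<close> and send the other variables into the disjoint pool, so frozen
  names stay fixed and the others go to names of \<open>\<Theta>\<close>.\<close>

lemma same_canon_renaming:
  assumes t: "fv_tm t \<union> fv_tm t' \<subseteq> F \<union> fset \<Theta>" and F: "F \<inter> fset \<Theta> = {}"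
    and s: "fv_tm s \<union> fv_tm s' \<subseteq> F \<union> fset \<Theta>'" and sub: "\<Theta>' |\<subseteq>| \<Theta>"
    and k: "canon \<kappa> t t'" and k': "canon \<kappa>' s s'"
    and eq: "ren_tm \<kappa> t = ren_tm \<kappa>' s" "ren_tm \<kappa> t' = ren_tm \<kappa>' s'"
  obtains \<sigma> where "renaming \<sigma> \<Theta>' \<Theta>" "ren_tm \<sigma> s = t" "ren_tm \<sigma> s' = t'"
proof -
  let ?V = "fv_tm t \<union> fv_tm t'" and ?W = "fv_tm s \<union> fv_tm s'"
  have subs: "x \<in> fset \<Theta>' \<Longrightarrow> x \<in> fset \<Theta>" for x using sub by blast
  have VW: "\<kappa> ` ?V = \<kappa>' ` ?W"
    using fv_ren(1)[of \<kappa> t] fv_ren(1)[of \<kappa> t'] unfolding eq by (simp add: image_Un)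
  have inj: "inj_on \<kappa> ?V" using k unfolding canon_def by blast
  have fixF: "\<And>x. x \<in> F \<Longrightarrow> \<kappa> x = x" "\<And>x. x \<in> F \<Longrightarrow> \<kappa>' x = x"
    and toB: "\<And>x. x \<in> ?V \<Longrightarrow> x \<notin> F \<Longrightarrow> \<kappa> x \<in> B" "\<And>x. x \<in> ?W \<Longrightarrow> x \<notin> F \<Longrightarrow> \<kappa>' x \<in> B"
    using k k' unfolding canon_def by blast+
  \<comment> \<open>Outside \<open>\<Theta>'\<close> a renaming has to be the identity; on names of
    \<open>\<Theta>'\<close> that do not occur in \<open>s\<close> or \<open>s'\<close> the identity
    is a default, legitimate by \<open>sub\<close>.\<close>
  define \<sigma> where "\<sigma> = (\<lambda>x. if x \<in> ?W \<inter> fset \<Theta>' then inv_into ?V \<kappa> (\<kappa>' x) else x)"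
  have \<sigma>: "\<sigma> x \<in> ?V \<and> \<kappa> (\<sigma> x) = \<kappa>' x" if x: "x \<in> ?W" for x
  proof (cases "x \<in> fset \<Theta>'")
    case True
    then have "\<sigma> x = inv_into ?V \<kappa> (\<kappa>' x)" using x by (simp add: \<sigma>_def)
    moreover have "\<kappa>' x \<in> \<kappa> ` ?V" using VW x by auto
    ultimately show ?thesis by (simp add: inv_into_into f_inv_into_f del: Un_iff)
  next
    case False
    then have xF: "x \<in> F" using s x by auto
    have \<sigma>x: "\<sigma> x = x" using False by (simp add: \<sigma>_def)
    have "x \<in> \<kappa> ` ?V" using VW x fixF(2)[OF xF] by (metis imageI)
    then obtain u where u: "u \<in> ?V" "x = \<kappa> u" by blast
    then have "u \<in> F" using toB(1)[of u] xF disj by blast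
    then show ?thesis using u fixF xF \<sigma>x by simp
  qed
  have "renaming \<sigma> \<Theta>' \<Theta>"
    unfolding renaming_def
  proof (intro conjI allI impI)
    fix x assume x: "x |\<in>| \<Theta>'"
    show "\<sigma> x |\<in>| \<Theta>"
    proof (cases "x \<in> ?W")
      case True
      have "x \<notin> F" using F subs[OF x] by blast
      then have "\<kappa> (\<sigma> x) \<in> B" using \<sigma>[OF True] toB(2)[OF True] by simp
      then have "\<sigma> x \<notin> F" using fixF(1)[of "\<sigma> x"] disj by auto
      then show ?thesis using \<sigma>[OF True] t by blast
    next
      case False
      then have "\<sigma> x = x" by (simp add: \<sigma>_def)
      then show ?thesis using subs[OF x] by simp
    qed
  qed (simp add: \<sigma>_def)
  moreover have "ren_tm \<sigma> a = b" if "fv_tm a \<subseteq> ?W" "fv_tm b \<subseteq> ?V" "ren_tm \<kappa> b = ren_tm \<kappa>' a" for a b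
  proof (rule ren_inj(1)[OF inj])
    have *: "\<sigma> x \<in> ?V \<and> \<kappa> (\<sigma> x) = \<kappa>' x" if "x \<in> fv_tm a" for x
      by (rule \<sigma>) (use that \<open>fv_tm a \<subseteq> ?W\<close> in blast)
    then show "fv_tm (ren_tm \<sigma> a) \<subseteq> ?V" by auto
    have "ren_tm \<kappa> (ren_tm \<sigma> a) = ren_tm \<kappa>' a" unfolding ren_comp by (rule ren_cong(1)) (simp add: *)
    then show "ren_tm \<kappa> (ren_tm \<sigma> a) = ren_tm \<kappa> b" using that(3) by simp
  qed (use that in blast)
  ultimately show ?thesis using that eq by blast
qed

text \<open>Contexts only grow during the search, so a stored context embeds into the current one;
  each variable of a stored pair is either frozen or movable by a renaming.\<close>

definition inv_ctx :: "assm list \<Rightarrow> name fset \<Rightarrow> bool" where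
  "inv_ctx \<Delta> \<Theta> \<longleftrightarrow> F \<inter> fset \<Theta> = {} \<and>
    (\<forall>(\<Theta>', s, s') \<in> set \<Delta>. \<Theta>' |\<subseteq>| \<Theta> \<and> fv_tm s \<union> fv_tm s' \<subseteq> F \<union> fset \<Theta>')"

lemma assm_or_progress:
  assumes inv: "inv_ctx \<Delta> \<Theta>"
    and w: "within (F \<union> fset \<Theta>) (Root H S)" "within (F \<union> fset \<Theta>) (Root H' S')"
  shows "eq_tm \<Sigma> \<Delta> \<Theta> (Root H S) (Root H' S') \<or>
    card (todo (\<Delta> @ [(\<Theta>, Root H S, Root H' S')])) < card (todo \<Delta>)"
proof -
  let ?t = "Root H S" and ?t' = "Root H' S'"
  obtain \<kappa> where k: "canon \<kappa> ?t ?t'" using canon_exists[OF w] .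
  show ?thesis
  proof (cases "realized \<Delta> (ren_tm \<kappa> ?t, ren_tm \<kappa> ?t')")
    case True
    then obtain \<Theta>' s s' \<kappa>' where s: "(\<Theta>', s, s') \<in> set \<Delta>" "canon \<kappa>' s s'"
      "ren_tm \<kappa> ?t = ren_tm \<kappa>' s" "ren_tm \<kappa> ?t' = ren_tm \<kappa>' s'"
      unfolding realized_def by blast
    have i: "F \<inter> fset \<Theta> = {}" "\<Theta>' |\<subseteq>| \<Theta>" "fv_tm s \<union> fv_tm s' \<subseteq> F \<union> fset \<Theta>'"
      using inv s(1) unfolding inv_ctx_def by blast+
    have "fv_tm ?t \<union> fv_tm ?t' \<subseteq> F \<union> fset \<Theta>" using within_fv w by blast
    from same_canon_renaming[OF this i(1,3,2) k s(2,3,4)]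
    obtain \<sigma> where r: "renaming \<sigma> \<Theta>' \<Theta>" "ren_tm \<sigma> s = ?t" "ren_tm \<sigma> s' = ?t'" .
    then obtain K U K' U' where "s = Root K U" "s' = Root K' U'"
      by (cases s; cases s') auto
    then have "eq_tm \<Sigma> \<Delta> \<Theta> (ren_tm \<sigma> s) (ren_tm \<sigma> s')"
      using eq_assm[OF _ r(1)] s(1) by blast
    then show ?thesis unfolding r(2,3) by blast
  next
    case False
    have "todo (\<Delta> @ [(\<Theta>, ?t, ?t')]) \<subseteq> todo \<Delta>"
      unfolding todo_def realized_def by auto
    moreover have "(ren_tm \<kappa> ?t, ren_tm \<kappa> ?t') \<in> todo \<Delta>"
      using canon_pairs[OF w k] False unfolding todo_def by blast
    moreover have "realized (\<Delta> @ [(\<Theta>, ?t, ?t')]) (ren_tm \<kappa> ?t, ren_tm \<kappa> ?t')"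
      unfolding realized_def using k by (metis in_set_conv_decomp)
    then have "(ren_tm \<kappa> ?t, ren_tm \<kappa> ?t') \<notin> todo (\<Delta> @ [(\<Theta>, ?t, ?t')])"
      unfolding todo_def by blast
    ultimately have "card (todo (\<Delta> @ [(\<Theta>, ?t, ?t')])) < card (todo \<Delta>)"
      by (intro psubset_card_mono finite_todo) blast
    then show ?thesis ..
  qed
qed

lemma within_whn:
  assumes "within X M" "whn \<Sigma> M P"
  shows "within X P"
  using assms(2,1)
proof cases
  case (whn_unfold r A K S)
  have "fv_spine S \<subseteq> X" using within_fv[OF assms(1)] whn_unfold(1) by auto
  then show ?thesis
    using hreduce_prepat_bounds[OF whn_unfold(3,5)] bodies[OF whn_unfold(2)]
    unfolding within_def by fastforce
qed simp

lemma inv_ctx_snoc: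
  assumes "inv_ctx \<Delta> \<Theta>" "within (F \<union> fset \<Theta>) t" "within (F \<union> fset \<Theta>) t'"
  shows "inv_ctx (\<Delta> @ [(\<Theta>, t, t')]) \<Theta>"
  using assms within_fv unfolding inv_ctx_def by auto

lemma bounded_complete:
  assumes "inv_ctx \<Delta> \<Theta>" "within (F \<union> fset \<Theta>) M" "within (F \<union> fset \<Theta>) M'" "bisim \<Sigma> M M'"
  shows "eq_tm \<Sigma> \<Delta> \<Theta> M M'"
  using assms
proof (induct "card (todo \<Delta>)" arbitrary: \<Delta> \<Theta> M M' rule: less_induct)
  case outer: less
  note IH = outer(1)
  from outer(2-5) show ?case
  proof (induct "tsize M" arbitrary: \<Theta> M M' rule: less_induct)
    case less
    note inv = less(2) and w = less(3,4) and eq = less(5)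
    have spine: "eq_spine \<Sigma> \<Delta> \<Theta> T T'" if "rel_spine (bisim \<Sigma>) T T'" "ssize T < tsize M" "ssize T' \<le> n"
      "syms_spine T \<subseteq> C \<union> FreeVar ` (F \<union> fset \<Theta>)" "syms_spine T' \<subseteq> C \<union> FreeVar ` (F \<union> fset \<Theta>)" for T T'
      using that
    proof (induct rule: rel_spine.induct)
      case (rel_spine_App K K' S S')
      have "eq_tm \<Sigma> \<Delta> \<Theta> K K'"
        by (rule less(1)[OF _ inv]) (use rel_spine_App w in \<open>auto simp: within_def\<close>)
      moreover have "eq_spine \<Sigma> \<Delta> \<Theta> S S'" using rel_spine_App by simp
      ultimately show ?case by (rule eq_App)
    qed (auto intro: eq_tm_eq_spine.intros)
    show ?case
    proof (cases M)
      case (Lam K)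
      obtain K' where K': "M' = Lam K'" "\<And>z. bisim \<Sigma> (open_tm 0 z K) (open_tm 0 z K')"
        using bisim_LamD[OF eq[unfolded Lam]] by blast
      let ?X = "F \<union> fset \<Theta> \<union> fv_tm K \<union> fv_tm K'"
      obtain z where z: "z \<notin> ?X" by (rule fresh_name[of ?X]) (use finF in auto)
      have "eq_tm \<Sigma> \<Delta> (finsert z \<Theta>) (open_tm 0 z K) (open_tm 0 z K')"
      proof (rule less(1))
        show "inv_ctx \<Delta> (finsert z \<Theta>)" using inv z unfolding inv_ctx_def by auto
        show "within (F \<union> fset (finsert z \<Theta>)) (open_tm 0 z K)"
          "within (F \<union> fset (finsert z \<Theta>)) (open_tm 0 z K')"
          using w syms_open(1)[of 0 z K] syms_open(1)[of 0 z K'] unfolding within_def Lam K'(1) by auto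
      qed (use Lam K'(2) in auto)
      then show ?thesis using z unfolding Lam K'(1) by (intro eq_Lam[of z]) auto
    next
      case (Root H S)
      obtain H' S' K T T' where M': "M' = Root H' S'" "whn \<Sigma> (Root H S) (Root K T)"
        "whn \<Sigma> (Root H' S') (Root K T')" "rel_spine (bisim \<Sigma>) T T'" "lc_head 0 K"
        using eq unfolding Root by (auto elim!: bisim_RootE) (metis tm.exhaust whn_LamE)
      let ?\<Delta> = "\<Delta> @ [(\<Theta>, Root H S, Root H' S')]"
      have K: "\<not> is_rec K" "whn \<Sigma> (Root K T) (Root K T)" "whn \<Sigma> (Root K T') (Root K T')"
        using whn_result[OF M'(2)] by (auto intro: whn_nonrec)
      \<comment> \<open>Either the goal is closed at once by an assumption, or the outer induction
        hypothesis becomes available after storing the pair, as both unfolding cases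
        require.\<close>
      have prog: "eq_tm \<Sigma> \<Delta> \<Theta> M M' \<or>
          card (todo ?\<Delta>) < card (todo \<Delta>)"
        using assm_or_progress[OF inv] w unfolding Root M'(1) by blast
      have inv': "inv_ctx ?\<Delta> \<Theta>" using inv_ctx_snoc[OF inv] w unfolding Root M'(1) by blast
      have wK: "within (F \<union> fset \<Theta>) (Root K T)" "within (F \<union> fset \<Theta>) (Root K T')"
        using within_whn w M'(1-3) Root by blast+
      consider "is_rec H" | "\<not> is_rec H" "is_rec H'" | "\<not> is_rec H" "\<not> is_rec H'" by blast
      then show ?thesis
      proof cases
        case 1
        then obtain r A N where r: "H = Rec r" "RecDef r A N \<in> set \<Sigma>" "prepat S" "contra N"
          "hreduce (erase A) S N (Root K T)"
          using M'(2) by (auto elim: whn_RootE)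
        have "bisim \<Sigma> (Root K T) M'" using bisim_Root[OF K(2) M'(3,5,4)] M'(1) by simp
        then have "eq_tm \<Sigma> ?\<Delta> \<Theta> (Root K T) M'" if "card (todo ?\<Delta>) < card (todo \<Delta>)"
          using IH[OF that inv' wK(1) w(2)] by blast
        then show ?thesis using prog eq_unfold_left[OF r(2-5)] unfolding Root M'(1) r(1) by blast
      next
        case 2
        then obtain r A N where r: "H' = Rec r" "RecDef r A N \<in> set \<Sigma>" "prepat S'" "contra N"
          "hreduce (erase A) S' N (Root K T')"
          using M'(3) by (auto elim: whn_RootE)
        have "bisim \<Sigma> M (Root K T')" using bisim_Root[OF M'(2) K(3) M'(5,4)] Root by simp
        then have "eq_tm \<Sigma> ?\<Delta> \<Theta> M (Root K T')" if "card (todo ?\<Delta>) < card (todo \<Delta>)"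
          using IH[OF that inv' w(1) wK(2)] by blast
        then show ?thesis using prog eq_unfold_right[OF r(2-4) 2(1) r(5)]
          unfolding Root M'(1) r(1) by blast
      next
        case 3
        have h: "K = H" "T = S" "H' = H" "T' = S'"
          using whn_nonrec_eq[OF M'(2)] whn_nonrec_eq[OF M'(3)] 3 by auto
        have "eq_spine \<Sigma> \<Delta> \<Theta> S S'"
          by (rule spine) (use M'(4) w h in \<open>auto simp: within_def Root M'(1)\<close>)
        \<comment> \<open>The closure premise in \<open>bisim_Root\<close> pays off here: no
          equality rule compares dangling indices.\<close>
        moreover have "(\<exists>c. H = Const c) \<or> (\<exists>y. H = FreeVar y)"
        proof (cases H)
          case (Var v)
          then show ?thesis using M'(5) h by (cases v) auto
        qed (use 3 in auto)
        ultimately show ?thesis unfolding Root M'(1) h(3) by (auto intro: eq_const eq_var)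
      qed
    qed
  qed
qed

end

section \<open>Completeness in arbitrary contexts\<close>

context colf begin

text \<open>The search is started on data read off \<open>M\<close>, \<open>M'\<close> and the
  finitely many definition bodies. \<open>F\<close> consists of the free variables outside
  \<open>\<Theta>\<close>, exactly those that a renaming from \<open>\<Theta>\<close> must
  fix.\<close>

lemma eq_complete:
  assumes "bisim \<Sigma> M M'"
  shows "eq_tm \<Sigma> [] \<Theta> M M'"
proof -
  define bodies where "bodies = {K. \<exists>r A. RecDef r A K \<in> set \<Sigma>}"
  have "bodies \<subseteq> (\<lambda>d. case d of RecDef r A K \<Rightarrow> K | _ \<Rightarrow> undefined) ` set \<Sigma>"
    unfolding bodies_def by force
  then have "finite bodies" by (rule finite_subset) simp
  let ?T = "insert M (insert M' bodies)"
  have fin: "finite ?T" using \<open>finite bodies\<close> by simp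
  define F where "F = fv_tm M \<union> fv_tm M' - fset \<Theta>"
  define n where "n = Max (tsize ` ?T)"
  define C where "C = \<Union> (syms_tm ` ?T) \<inter> {H. fv_head H = {}}"
  have n: "tsize K \<le> n" if "K \<in> ?T" for K unfolding n_def using fin that by (intro Max_ge) auto
  have "infinite (UNIV - F)" unfolding F_def by (intro Diff_infinite_finite) auto
  then obtain B where B: "finite B" "card B = 2 * n" "B \<subseteq> UNIV - F"
    using infinite_arbitrarily_large by blast
  interpret bounded \<Sigma> F B C n
  proof
    show "finite C" unfolding C_def using fin by auto
    fix r A K assume K: "RecDef r A K \<in> set \<Sigma>"
    then have b: "K \<in> bodies" unfolding bodies_def by blast
    have "syms_tm K \<subseteq> C" unfolding C_def using b fv_def[OF K] unfolding fv_syms by auto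
    then show "tsize K \<le> n \<and> syms_tm K \<subseteq> C" using n b by simp
  qed (use B in \<open>auto simp: F_def C_def\<close>)
  have "within (F \<union> fset \<Theta>) L" if L: "L \<in> {M, M'}" for L
  proof -
    have "H \<in> C \<union> FreeVar ` (F \<union> fset \<Theta>)" if "H \<in> syms_tm L" for H
    proof (cases "fv_head H = {}")
      case True
      then show ?thesis using that L unfolding C_def by auto
    next
      case False
      then obtain x where "x \<in> fv_head H" by blast
      moreover from this have "x \<in> fv_tm L" using that unfolding fv_syms by blast
      ultimately show ?thesis using L unfolding F_def by (auto simp: mem_fv_head)
    qed
    then show ?thesis unfolding within_def using n L by auto
  qed
  moreover have "inv_ctx [] \<Theta>" unfolding inv_ctx_def by (auto simp: F_def)
  ultimately show ?thesis using bounded_complete assms by blast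
qed

end

section \<open>Compatibility of equality with hereditary substitution\<close>

theorem theorem11:
  fixes \<Sigma> :: sig
    and \<Theta> \<Theta>' :: "name fset"
    and M M' N N' P P' :: tm
    and x :: name
    and \<tau> :: sty
  assumes "colf_signature \<Sigma>"
    and "is_tm N" and "is_tm N'" and "is_tm M" and "is_tm M'"
    and "eq_tm \<Sigma> [] \<Theta>' N N'"
    and "eq_tm \<Sigma> [] \<Theta> M M'"
    and "hsubst \<tau> N x M P"
    and "hsubst \<tau> N' x M' P'"
  shows "eq_tm \<Sigma> [] (\<Theta> |\<union>| \<Theta>') P P'"
proof -
  interpret colf \<Sigma> by unfold_locales fact
  have "bisim \<Sigma> N N'" "bisim \<Sigma> M M'" using assms(6,7) by (auto intro: eq_sound)
  then have "bisim \<Sigma> P P'" using hsubst_bisim(1)[OF assms(8), of "\<lambda>x. x" N' M' P'] assms(9) by simp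
  \<comment> \<open>Soundness forgot the two contexts; completeness yields a derivation in any
    context, in particular in the union.\<close>
  then show ?thesis by (rule eq_complete)
qed

end
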